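(* Let $\Omega\subset\mathbb{R}^n$ be a bounded domain with smooth boundary containing the origin, let $1<q<2$, $\alpha,t\in\mathbb{R}$, and assume $Q+\alpha-2>0$. Then there exists a constant $C>0$ (depending on $Q,q,\alpha,t,\Omega$ but not on $\phi$) such that for every $\phi\in C_0^\infty(\Omega)$, $$\int_\Omega\rho^{\alpha}|\nabla_\gamma\rho|^t|\nabla_\gamma\phi|^2\,dz\ \ge\ \Big(\frac{Q+\alpha-2}{2}\Big)^2\int_\Omega\rho^{\alpha}\frac{|\nabla_\gamma\rho|^{t+2}}{\rho^2}\phi^2\,dz+C\Big(\int_\Omega|\nabla_\gamma\phi|^q\big(|\nabla_\gamma\rho|^t\rho^{\alpha}\big)^{q/2}\,dz\Big)^{2/q}.$$
   Context: Points of $\mathbb{R}^n$ are written $z=(x,y)$ with $x\in\mathbb{R}^m$, $y\in\mathbb{R}^k$, $m,k\ge1$, $n=m+k$, and $\gamma>0$. The Baouendi–Grushin gradient is $\nabla_\gamma=(\partial_{x_1},\dots,\partial_{x_m},|x|^\gamma\partial_{y_1},\dots,|x|^\gamma\partial_{y_k})$. The homogeneous dimension is $Q=m+(1+\gamma)k$. The gauge is $\rho(z)=\big(|x|^{2(1+\gamma)}+(1+\gamma)^2|y|^2\big)^{\frac{1}{2(1+\gamma)}}$; one has $|\nabla_\gamma\rho|=|x|^\gamma/\rho^\gamma$. The integral on the left-hand side is allowed to be $+\infty$. *)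

theory Defs
  imports "HOL-Analysis.Analysis"
begin

fun dirderiv :: "'a::real_normed_vector list \<Rightarrow> ('a \<Rightarrow> real) \<Rightarrow> 'a \<Rightarrow> real" where
  "dirderiv [] f = f"
| "dirderiv (v # vs) f = (\<lambda>z. frechet_derivative (dirderiv vs f) (at z) v)"

text \<open>C-infinity on an open set U: all iterated derivatives exist (hence are continuous).\<close>
definition smooth_on :: "'a::real_normed_vector set \<Rightarrow> ('a \<Rightarrow> real) \<Rightarrow> bool" where
  "smooth_on U f \<longleftrightarrow> (\<forall>vs. \<forall>z\<in>U. dirderiv vs f differentiable (at z))"

definition test_fun :: "'a::euclidean_space set \<Rightarrow> ('a \<Rightarrow> real) \<Rightarrow> bool" where
  "test_fun \<Omega> f \<longleftrightarrow> smooth_on UNIV f \<and> compact (closure {z. f z \<noteq> 0})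
      \<and> closure {z. f z \<noteq> 0} \<subseteq> \<Omega>"

definition smooth_bounded_domain :: "'a::euclidean_space set \<Rightarrow> bool" where
  "smooth_bounded_domain \<Omega> \<longleftrightarrow> open \<Omega> \<and> connected \<Omega> \<and> bounded \<Omega> \<and> \<Omega> \<noteq> {} \<and>
     (\<forall>p\<in>frontier \<Omega>. \<exists>U g. open U \<and> p \<in> U \<and> smooth_on U g \<and>
        (\<forall>z\<in>U. frechet_derivative g (at z) \<noteq> (\<lambda>_. 0)) \<and>
        \<Omega> \<inter> U = {z\<in>U. g z < 0})"

definition grushin_grad_norm :: "real \<Rightarrow> ((real^'m::finite) \<times> (real^'k::finite) \<Rightarrow> real) \<Rightarrow> (real^'m::finite) \<times> (real^'k::finite) \<Rightarrow> real" where
  "grushin_grad_norm \<gamma> f z = sqrt ((\<Sum>i\<in>UNIV. (frechet_derivative f (at z) (axis i 1, 0))\<^sup>2)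
      + (norm (fst z) powr \<gamma>)\<^sup>2 * (\<Sum>j\<in>UNIV. (frechet_derivative f (at z) (0, axis j 1))\<^sup>2))"

definition gauge :: "real \<Rightarrow> (real^'m::finite) \<times> (real^'k::finite) \<Rightarrow> real" where
  "gauge \<gamma> z = (norm (fst z) powr (2*(1+\<gamma>)) + (1+\<gamma>)\<^sup>2 * (norm (snd z))\<^sup>2) powr (1/(2*(1+\<gamma>)))"

text \<open>Real power on extended nonnegative reals (p > 0): infinity stays infinity.\<close>
definition ennreal_powr :: "ennreal \<Rightarrow> real \<Rightarrow> ennreal" where
  "ennreal_powr a p = (if a = \<infinity> then \<infinity> else ennreal (enn2real a powr p))"

end

theory Submission
  imports Defs
begin

text \<open>With \<open>\<psi> = |x|^\<gamma> / \<rho>^\<gamma>\<close> one has \<open>\<nabla>\<rho> \<bullet> \<nabla>\<phi> = \<psi>^2 / \<rho> * Z \<phi>\<close>, where \<open>Z\<close> generates the anisotropic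
  dilations, so Cauchy-Schwarz gives \<open>\<psi>^2 / \<rho>^2 * (Z \<phi>)^2 \<le> |\<nabla>\<phi>|^2\<close>, and \<open>\<psi>\<close> is constant along the orbits of
  the dilations. The inequality is therefore one-dimensional on each orbit, which also makes it
  insensitive to the integrability of the weight across \<open>x = 0\<close>. With \<open>a = Q + \<alpha> - 2\<close>, subtracting from
  \<open>e^(a s) f'^2\<close> the exact derivative of \<open>- e^(a s) (a/2 + \<delta> \<rho>^\<epsilon>) f^2\<close> and completing the square leaves the sharp
  Hardy term together with a positive multiple of \<open>\<rho>^\<epsilon>\<close> times the energy. This weighted \<open>L^2\<close> remainder
  dominates the \<open>L^q\<close> norm by Hoelder's inequality, since \<open>\<epsilon>\<close> is chosen such that the dual weight is
  \<open>\<rho>^(- Q/2)\<close>, which is integrable on \<open>\<Omega>\<close>.\<close>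

section \<open>The gauge and its dilations\<close>

text \<open>The logarithmic parameter \<open>s\<close> makes each orbit a copy of the whole real
  line, with \<open>dilation \<gamma> s\<close> a one-parameter group, so that homogeneous factors
  become exponentials in \<open>s\<close>. The generator is the field
  \<open>(x, (1 + \<gamma>) y)\<close>.\<close>

definition dilation :: "real \<Rightarrow> real \<Rightarrow> 'a::real_vector \<times> 'b::real_vector \<Rightarrow> 'a \<times> 'b" where
  "dilation \<gamma> s z = (exp s *\<^sub>R fst z, exp ((1 + \<gamma>) * s) *\<^sub>R snd z)"

text \<open>This is the closed form of \<open>|x|^\<gamma> / \<rho>^\<gamma>\<close>, the length of
  the Grushin gradient of the gauge off \<open>x = 0\<close>. As a power of a ratio of two
  quantities of degree one, it is invariant under the dilations.\<close>

definition gauge_slope :: "real \<Rightarrow> (real^'m::finite) \<times> (real^'k::finite) \<Rightarrow> real" where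
  "gauge_slope \<gamma> z = (norm (fst z) / gauge \<gamma> z) powr \<gamma>"

lemma gauge_pos:
  assumes "fst z \<noteq> 0" and "\<gamma> > 0"
  shows "gauge \<gamma> z > 0"
proof -
  have "norm (fst z) powr (2*(1+\<gamma>)) + (1+\<gamma>)\<^sup>2 * (norm (snd z))\<^sup>2 > 0"
    using assms by (intro add_pos_nonneg) simp_all
  then show ?thesis by (simp add: gauge_def)
qed

lemma gauge_nonneg: "gauge \<gamma> z \<ge> 0"
  by (simp add: gauge_def)

lemma gauge_powr:
  assumes "\<gamma> > 0"
  shows "gauge \<gamma> z powr (2 * (1 + \<gamma>)) = norm (fst z) powr (2*(1+\<gamma>)) + (1+\<gamma>)\<^sup>2 * (norm (snd z))\<^sup>2"
  using assms by (simp add: gauge_def powr_powr add_nonneg_nonneg)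

lemma powr_two_times_one_plus:
  fixes r :: real
  assumes "r > 0"
  shows "r powr (2 * (1 + \<gamma>)) = r\<^sup>2 * (r powr \<gamma>)\<^sup>2"
proof -
  have "r powr (2 * (1 + \<gamma>)) = r powr (2 + (\<gamma> + \<gamma>))"
    by (simp add: algebra_simps)
  also have "\<dots> = r\<^sup>2 * (r powr \<gamma>)\<^sup>2"
    using assms by (simp only: powr_add) (simp add: power2_eq_square)
  finally show ?thesis .
qed

lemma gauge_dilation:
  assumes "\<gamma> > 0"
  shows "gauge \<gamma> (dilation \<gamma> s z) = exp s * gauge \<gamma> z"
proof -
  define p where "p = 2 * (1 + \<gamma>)"
  have p: "p > 0" using assms by (simp add: p_def)
  have "(exp s * norm (fst z)) powr p = exp (p * s) * norm (fst z) powr p"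
    by (simp add: powr_mult exp_powr_real mult.commute)
  moreover have "(exp ((1 + \<gamma>) * s) * norm (snd z))\<^sup>2 = exp (p * s) * (norm (snd z))\<^sup>2"
    by (simp add: power_mult_distrib p_def exp_double[symmetric] algebra_simps)
  ultimately have "gauge \<gamma> (dilation \<gamma> s z) =
      (exp (p * s) * (norm (fst z) powr p + (1+\<gamma>)\<^sup>2 * (norm (snd z))\<^sup>2)) powr (1 / p)"
    unfolding gauge_def p_def[symmetric] by (simp add: dilation_def distrib_left mult.left_commute)
  also have "\<dots> = exp s * gauge \<gamma> z"
    using p by (simp add: powr_mult exp_powr_real gauge_def p_def)
  finally show ?thesis .
qed

lemma gauge_slope_dilation:
  assumes "\<gamma> > 0"
  shows "gauge_slope \<gamma> (dilation \<gamma> s z) = gauge_slope \<gamma> z"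
  using assms by (simp add: gauge_slope_def gauge_dilation) (simp add: dilation_def)

section \<open>The Grushin gradient of the gauge and the radial derivative\<close>

lemma has_derivative_gauge:
  fixes x :: "real^'m" and y :: "real^'k"
  assumes g: "\<gamma> > 0" and x: "x \<noteq> 0"
  shows "(gauge \<gamma> has_derivative
    (\<lambda>v. gauge \<gamma> (x, y) powr (1 - 2 * (1 + \<gamma>)) *
        (norm x powr (2 * \<gamma>) * (x \<bullet> fst v) + (1 + \<gamma>) * (y \<bullet> snd v)))) (at (x, y))"
proof -
  define p where "p = 1 / (2 * (1 + \<gamma>))"
  \<comment> \<open>Writing the norms as inner products makes them differentiable by the product
    rule; \<open>x \<noteq> 0\<close> keeps the bases of both real powers positive.\<close>
  define N where "N = (\<lambda>z::(real^'m)\<times>(real^'k).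
     (fst z \<bullet> fst z) powr (1 + \<gamma>) + (1 + \<gamma>)\<^sup>2 * (snd z \<bullet> snd z))"
  have gN: "gauge \<gamma> = (\<lambda>z. N z powr p)"
  proof
    fix z :: "(real^'m)\<times>(real^'k)"
    have "(fst z \<bullet> fst z) powr (1 + \<gamma>) = norm (fst z) powr (2 * (1 + \<gamma>))"
      by (cases "fst z = 0") (simp_all add: power2_norm_eq_inner[symmetric] powr_powr flip: powr_numeral)
    then show "gauge \<gamma> z = N z powr p"
      by (simp add: gauge_def N_def p_def power2_norm_eq_inner)
  qed
  have Npos: "N (x, y) > 0"
    using x g by (simp add: N_def add_pos_nonneg)
  have xx: "(x \<bullet> x) powr \<gamma> = norm x powr (2 * \<gamma>)"
    using x by (simp add: power2_norm_eq_inner[symmetric] powr_powr flip: powr_numeral)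
  have d1: "((\<lambda>z. (fst z \<bullet> fst z) powr (1 + \<gamma>)) has_derivative
      (\<lambda>v. 2 * (1 + \<gamma>) * (norm x powr (2 * \<gamma>) * (x \<bullet> fst v)))) (at (x, y))"
  proof -
    have "((\<lambda>z::(real^'m)\<times>(real^'k). fst z \<bullet> fst z) has_derivative (\<lambda>v. 2 * (x \<bullet> fst v))) (at (x, y))"
      by (rule derivative_eq_intros refl | simp)+ (simp add: inner_commute)
    moreover have "((\<lambda>u. u powr (1 + \<gamma>)) has_real_derivative (1 + \<gamma>) * (x \<bullet> x) powr (1 + \<gamma> - 1)) (at (x \<bullet> x))"
      using x by (intro has_real_derivative_powr) simp
    ultimately have "((\<lambda>z. (fst z \<bullet> fst z) powr (1 + \<gamma>)) has_derivative
      (\<lambda>v. 2 * (x \<bullet> fst v) * ((1 + \<gamma>) * (x \<bullet> x) powr (1 + \<gamma> - 1)))) (at (x, y))"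
      by (intro DERIV_compose_FDERIV) simp_all
    then show ?thesis by (simp add: xx algebra_simps)
  qed
  have dN: "(N has_derivative (\<lambda>v. 2 * (1 + \<gamma>) *
       (norm x powr (2 * \<gamma>) * (x \<bullet> fst v) + (1 + \<gamma>) * (y \<bullet> snd v)))) (at (x, y))"
  proof -
    have "((\<lambda>z::(real^'m)\<times>(real^'k). snd z \<bullet> snd z) has_derivative (\<lambda>v. 2 * (y \<bullet> snd v))) (at (x, y))"
      by (rule derivative_eq_intros refl | simp)+ (simp add: inner_commute)
    from has_derivative_add[OF d1 has_derivative_mult_right[OF this, of "(1 + \<gamma>)\<^sup>2"]] show ?thesis
      unfolding N_def by (simp add: algebra_simps power2_eq_square)
  qed
  have "((\<lambda>z. N z powr p) has_derivative (\<lambda>v. (2 * (1 + \<gamma>) *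
       (norm x powr (2 * \<gamma>) * (x \<bullet> fst v) + (1 + \<gamma>) * (y \<bullet> snd v))) * (p * N (x, y) powr (p - 1)))) (at (x, y))"
    by (rule DERIV_compose_FDERIV[OF has_real_derivative_powr[OF Npos] dN])
  also have "(\<lambda>v. (2 * (1 + \<gamma>) * (norm x powr (2 * \<gamma>) * (x \<bullet> fst v) + (1 + \<gamma>) * (y \<bullet> snd v)))
        * (p * N (x, y) powr (p - 1)))
      = (\<lambda>v. N (x, y) powr (p - 1) * (norm x powr (2 * \<gamma>) * (x \<bullet> fst v) + (1 + \<gamma>) * (y \<bullet> snd v)))"
    using g by (auto simp: fun_eq_iff p_def)
  also have "N (x, y) powr (p - 1) = gauge \<gamma> (x, y) powr (1 - 2 * (1 + \<gamma>))"
    using g by (simp add: gN powr_powr p_def field_simps)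
  finally show ?thesis
    unfolding gN .
qed

text \<open>After factoring \<open>A^2 |x|^(2\<gamma>)\<close> out of the sum of squares, what
  remains is \<open>|x|^(2+2\<gamma>) + (1+\<gamma>)^2 |y|^2\<close>, which is again a power of the
  gauge; only \<open>|x|^(2\<gamma>) \<rho>^(-2\<gamma>)\<close> survives.\<close>

lemma grushin_grad_norm_gauge:
  fixes z :: "(real^'m::finite) \<times> (real^'k::finite)"
  assumes g: "\<gamma> > 0" and x: "fst z \<noteq> 0"
  shows "grushin_grad_norm \<gamma> (gauge \<gamma>) z = gauge_slope \<gamma> z"
proof -
  obtain x y where z: "z = (x, y)" by (cases z)
  define r where "r = gauge \<gamma> z"
  define n where "n = norm x"
  have r: "r > 0" using gauge_pos[OF x g] by (simp add: r_def)
  have n: "n > 0" using x by (simp add: n_def z)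
  define A where "A = r powr (1 - 2 * (1 + \<gamma>))"
  have D: "frechet_derivative (gauge \<gamma>) (at z) =
      (\<lambda>v. A * (n powr (2 * \<gamma>) * (x \<bullet> fst v) + (1 + \<gamma>) * (y \<bullet> snd v)))"
    using has_derivative_gauge[of \<gamma> x y] x g
    by (simp add: frechet_derivative_at[symmetric] z A_def r_def n_def)
  have sx: "(\<Sum>i\<in>UNIV. (x $ i)\<^sup>2) = n\<^sup>2" and sy: "(\<Sum>i\<in>UNIV. (y $ i)\<^sup>2) = (norm y)\<^sup>2"
    by (simp_all add: n_def power2_norm_eq_inner inner_vec_def) (simp_all add: power2_eq_square)
  have n2: "n powr (2 * \<gamma>) = (n powr \<gamma>)\<^sup>2"
    by (simp add: power2_eq_square flip: powr_add)
  have "n powr (2 * (1 + \<gamma>)) = n powr (2 + 2 * \<gamma>)" by (simp add: algebra_simps)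
  also have "\<dots> = n\<^sup>2 * n powr (2 * \<gamma>)"
    using n by (simp add: powr_add)
  finally have key: "n\<^sup>2 * (n powr \<gamma>)\<^sup>2 + (1 + \<gamma>)\<^sup>2 * (norm y)\<^sup>2 = r powr (2 * (1 + \<gamma>))"
    using gauge_powr[OF g, of z] by (simp add: r_def z flip: n2 n_def)
  have "(\<Sum>i\<in>UNIV. (frechet_derivative (gauge \<gamma>) (at z) (axis i 1, 0))\<^sup>2)
      = A\<^sup>2 * ((n powr \<gamma>)\<^sup>2)\<^sup>2 * n\<^sup>2"
    by (simp add: D n2 inner_axis power_mult_distrib flip: sum_distrib_left sx)
  moreover have "(\<Sum>j\<in>UNIV. (frechet_derivative (gauge \<gamma>) (at z) (0, axis j 1))\<^sup>2)
      = A\<^sup>2 * (1 + \<gamma>)\<^sup>2 * (norm y)\<^sup>2"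
    by (simp add: D inner_axis power_mult_distrib flip: sum_distrib_left sy)
  ultimately have "(grushin_grad_norm \<gamma> (gauge \<gamma>) z)\<^sup>2
      = A\<^sup>2 * (n powr \<gamma>)\<^sup>2 * (n\<^sup>2 * (n powr \<gamma>)\<^sup>2 + (1 + \<gamma>)\<^sup>2 * (norm y)\<^sup>2)"
    by (simp add: grushin_grad_norm_def n_def[symmetric] z sum_nonneg)
      (simp add: algebra_simps power2_eq_square power4_eq_xxxx)
  also have "\<dots> = (n powr \<gamma>)\<^sup>2 * (A * A * r powr (2 * (1 + \<gamma>)))"
    by (simp only: key) (simp add: power2_eq_square mult_ac)
  also have "A * A * r powr (2 * (1 + \<gamma>)) = (r powr (- \<gamma>))\<^sup>2"
    by (simp add: A_def power2_eq_square flip: powr_add)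
  also have "(n powr \<gamma>)\<^sup>2 * (r powr (- \<gamma>))\<^sup>2 = (gauge_slope \<gamma> z)\<^sup>2"
    using n r by (simp add: gauge_slope_def powr_divide powr_minus z n_def r_def power_mult_distrib power_divide divide_simps)
  finally show ?thesis
    by (rule power2_eq_imp_eq) (simp_all add: gauge_slope_def grushin_grad_norm_def sum_nonneg)
qed

lemma frechet_derivative_pair_expand:
  fixes z :: "(real^'m::finite) \<times> (real^'k::finite)"
  assumes "\<phi> differentiable (at z)"
  shows "frechet_derivative \<phi> (at z) (u, v) =
    (\<Sum>i\<in>UNIV. frechet_derivative \<phi> (at z) (axis i 1, 0) * u $ i) +
    (\<Sum>j\<in>UNIV. frechet_derivative \<phi> (at z) (0, axis j 1) * v $ j)"
proof -
  interpret linear "frechet_derivative \<phi> (at z)"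
    by (rule linear_frechet_derivative[OF assms])
  have "(u, v) = (\<Sum>i\<in>UNIV. u $ i *\<^sub>R (axis i 1, 0)) + (\<Sum>j\<in>UNIV. v $ j *\<^sub>R (0, axis j 1))"
    by (simp add: prod_eq_iff fst_sum snd_sum vec_eq_iff axis_def if_distrib cong: if_cong)
  then show ?thesis
    by (simp only: add sum scale) (simp add: mult.commute)
qed

text \<open>The left-hand side involves only the derivative along the generator of the dilations, so
  this bound is what reduces the problem to single orbits. It is Cauchy-Schwarz after the weight
  \<open>|x|^\<gamma>\<close> has been shared between the two factors.\<close>

lemma radial_derivative_bound:
  fixes z :: "(real^'m::finite) \<times> (real^'k::finite)"
  assumes g: "\<gamma> > 0" and x: "fst z \<noteq> 0" and d: "\<phi> differentiable (at z)"
  shows "(gauge_slope \<gamma> z)\<^sup>2 / (gauge \<gamma> z)\<^sup>2 *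
      (frechet_derivative \<phi> (at z) (fst z, (1 + \<gamma>) *\<^sub>R snd z))\<^sup>2 \<le> (grushin_grad_norm \<gamma> \<phi> z)\<^sup>2"
proof -
  obtain x y where z: "z = (x, y)" by (cases z)
  define r where "r = gauge \<gamma> z"
  define c where "c = norm x powr \<gamma>"
  have r: "r > 0" using gauge_pos[OF x g] by (simp add: r_def)
  have n: "norm x > 0" using x by (simp add: z)
  then have c: "c > 0" by (simp add: c_def)
  define p :: "real^'m" where "p = (\<chi> i. frechet_derivative \<phi> (at z) (axis i 1, 0))"
  define b :: "real^'k" where "b = (\<chi> j. frechet_derivative \<phi> (at z) (0, axis j 1))"
  have "frechet_derivative \<phi> (at z) (fst z, (1 + \<gamma>) *\<^sub>R snd z) = p \<bullet> x + b \<bullet> ((1 + \<gamma>) *\<^sub>R y)"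
    by (subst frechet_derivative_pair_expand[OF d]) (simp add: p_def b_def inner_vec_def z)
  \<comment> \<open>The factor \<open>c\<close> completes \<open>b\<close> to the
    \<open>y\<close>-part of the Grushin gradient and is compensated in the position vector, whose
    squared length then is \<open>\<rho>^2\<close> over the squared slope.\<close>
  also have "\<dots> = (p, c *\<^sub>R b) \<bullet> (x, ((1 + \<gamma>) / c) *\<^sub>R y)"
    using c by (simp add: inner_prod_def)
  also have "\<dots>\<^sup>2 \<le> ((norm (p, c *\<^sub>R b)) * norm (x, ((1 + \<gamma>) / c) *\<^sub>R y))\<^sup>2"
    by (rule abs_le_square_iff[THEN iffD1, OF order_trans[OF Cauchy_Schwarz_ineq2 abs_ge_self]])
  also have "\<dots> = (norm (p, c *\<^sub>R b))\<^sup>2 * ((norm x)\<^sup>2 + (1 + \<gamma>)\<^sup>2 * (norm y)\<^sup>2 / c\<^sup>2)"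
    by (simp add: power_mult_distrib norm_prod_def power_divide)
  also have "(norm (p, c *\<^sub>R b))\<^sup>2 = (grushin_grad_norm \<gamma> \<phi> z)\<^sup>2"
    by (simp add: norm_prod_def power_mult_distrib grushin_grad_norm_def sum_nonneg
        power2_norm_eq_inner c_def z) (simp add: inner_vec_def p_def b_def z power2_eq_square)
  also have "(norm x)\<^sup>2 + (1 + \<gamma>)\<^sup>2 * (norm y)\<^sup>2 / c\<^sup>2 = r\<^sup>2 / (gauge_slope \<gamma> z)\<^sup>2"
  proof -
    have "(norm x)\<^sup>2 * c\<^sup>2 = norm x powr (2 * (1 + \<gamma>))"
      using powr_two_times_one_plus[OF n, of \<gamma>] by (simp add: c_def)
    then have "(norm x)\<^sup>2 * c\<^sup>2 + (1 + \<gamma>)\<^sup>2 * (norm y)\<^sup>2 = r powr (2 * (1 + \<gamma>))"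
      using gauge_powr[OF g, of z] by (simp add: z r_def)
    also have "\<dots> = r\<^sup>2 * (r powr \<gamma>)\<^sup>2"
      by (rule powr_two_times_one_plus[OF r])
    finally have "(norm x)\<^sup>2 + (1 + \<gamma>)\<^sup>2 * (norm y)\<^sup>2 / c\<^sup>2 = r\<^sup>2 * (r powr \<gamma>)\<^sup>2 / c\<^sup>2"
      using c by (simp add: field_simps)
    also have "\<dots> = r\<^sup>2 / (gauge_slope \<gamma> z)\<^sup>2"
      using r n by (simp add: gauge_slope_def powr_divide power_divide c_def r_def z)
    finally show ?thesis .
  qed
  finally have "(frechet_derivative \<phi> (at z) (fst z, (1 + \<gamma>) *\<^sub>R snd z))\<^sup>2
      \<le> (grushin_grad_norm \<gamma> \<phi> z)\<^sup>2 * (r\<^sup>2 / (gauge_slope \<gamma> z)\<^sup>2)" .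
  moreover have "gauge_slope \<gamma> z > 0"
    using n r by (simp add: gauge_slope_def z r_def)
  ultimately show ?thesis
    using r by (simp add: r_def[symmetric] field_simps)
qed

section \<open>Integration along the orbits of the dilations\<close>

lemma dilation_dilation: "dilation \<gamma> s (dilation \<gamma> r z) = dilation \<gamma> (s + r) z"
  by (simp add: dilation_def exp_add[symmetric] distrib_left)

lemma dilation_0: "dilation \<gamma> 0 z = z"
  by (simp add: dilation_def)

lemma continuous_dilation [continuous_intros]:
  fixes z :: "'c::t2_space \<Rightarrow> 'a::real_normed_vector \<times> 'b::real_normed_vector"
  assumes "continuous_on A s" and "continuous_on A z"
  shows "continuous_on A (\<lambda>x. dilation \<gamma> (s x) (z x))"
  unfolding dilation_def by (intro continuous_intros assms)

lemma measurable_dilation [measurable]: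
  fixes z :: "'c \<Rightarrow> 'a::euclidean_space \<times> 'b::euclidean_space"
  assumes [measurable]: "s \<in> borel_measurable M" "z \<in> borel_measurable M"
  shows "(\<lambda>x. dilation \<gamma> (s x) (z x)) \<in> borel_measurable M"
proof -
  have "(\<lambda>x. dilation \<gamma> (fst x) (snd x :: 'a \<times> 'b)) \<in> borel_measurable borel"
    by (intro borel_measurable_continuous_onI continuous_intros)
  from measurable_compose[OF _ this, of "\<lambda>x. (s x, z x)" M] show ?thesis by simp
qed

lemma measurable_gauge [measurable]:
  "(gauge \<gamma> :: (real^'m::finite) \<times> (real^'k::finite) \<Rightarrow> real) \<in> borel_measurable borel"
proof -
  have [measurable]: "(\<lambda>z::(real^'m) \<times> (real^'k). norm (fst z)) \<in> borel_measurable borel"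
    "(\<lambda>z::(real^'m) \<times> (real^'k). norm (snd z)) \<in> borel_measurable borel"
    by (intro borel_measurable_continuous_onI continuous_intros)+
  show ?thesis unfolding gauge_def[abs_def] by simp
qed

lemma measurable_gauge_slope [measurable]:
  "(gauge_slope \<gamma> :: (real^'m::finite) \<times> (real^'k::finite) \<Rightarrow> real) \<in> borel_measurable borel"
proof -
  have [measurable]: "(\<lambda>z::(real^'m) \<times> (real^'k). norm (fst z)) \<in> borel_measurable borel"
    by (intro borel_measurable_continuous_onI continuous_intros)
  show ?thesis unfolding gauge_slope_def[abs_def] by simp
qed

text \<open>The formulas for the gradient of the gauge hold off \<open>x = 0\<close>; this null set
  is discarded whenever they are integrated.\<close>

lemma AE_fst_nonzero:
  "AE z in (lborel :: ('a::euclidean_space \<times> 'b::euclidean_space) measure). fst z \<noteq> 0"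
proof (rule AE_I)
  show "{z \<in> space lborel. \<not> fst z \<noteq> 0} \<subseteq> {0 :: 'a} \<times> (UNIV :: 'b set)" by auto
  show "emeasure lborel ({0 :: 'a} \<times> (UNIV :: 'b set)) = 0"
    by (subst lborel_prod[symmetric], subst lborel.emeasure_pair_measure_Times) auto
  show "{0 :: 'a} \<times> (UNIV :: 'b set) \<in> sets lborel"
    by (simp add: borel_closed closed_Times)
qed

lemma nn_integral_lborel_scaleR:
  fixes F :: "'a::euclidean_space \<Rightarrow> ennreal"
  assumes [measurable]: "F \<in> borel_measurable borel" and c: "c > 0"
  shows "(\<integral>\<^sup>+x. F x \<partial>lborel) = ennreal (c ^ DIM('a)) * (\<integral>\<^sup>+x. F (c *\<^sub>R x) \<partial>lborel)"
  using c by (subst lborel_affine[of c 0])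
    (simp_all add: nn_integral_density nn_integral_distr nn_integral_cmult)

lemma nn_integral_lborel_pair:
  fixes F :: "'a::euclidean_space \<times> 'b::euclidean_space \<Rightarrow> ennreal"
  assumes [measurable]: "F \<in> borel_measurable borel"
  shows "(\<integral>\<^sup>+z. F z \<partial>lborel) = (\<integral>\<^sup>+x. \<integral>\<^sup>+y. F (x, y) \<partial>lborel \<partial>lborel)"
  by (subst lborel_prod[symmetric], subst lborel.nn_integral_fst) (simp_all add: lborel_prod)

text \<open>Scaling \<open>y\<close> and \<open>x\<close> separately gives the Jacobian
  \<open>exp ((1 + \<gamma>) s)^k * exp(s)^m\<close>, whose exponent is the homogeneous dimension
  times \<open>s\<close>.\<close>

lemma nn_integral_dilation:
  fixes F :: "(real^'m::finite) \<times> (real^'k::finite) \<Rightarrow> ennreal"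
  assumes [measurable]: "F \<in> borel_measurable borel"
  shows "(\<integral>\<^sup>+z. F z \<partial>lborel) =
    ennreal (exp ((real CARD('m) + (1 + \<gamma>) * real CARD('k)) * s)) * (\<integral>\<^sup>+z. F (dilation \<gamma> s z) \<partial>lborel)"
proof -
  define b where "b = exp ((1 + \<gamma>) * s)"
  have b: "b > 0" by (simp add: b_def)
  have "(\<integral>\<^sup>+z. F z \<partial>lborel) = (\<integral>\<^sup>+x. \<integral>\<^sup>+y. F (x, y) \<partial>lborel \<partial>lborel)"
    by (rule nn_integral_lborel_pair) simp
  also have "\<dots> = (\<integral>\<^sup>+x. ennreal (b ^ CARD('k)) * (\<integral>\<^sup>+y. F (x, b *\<^sub>R y) \<partial>lborel) \<partial>lborel)"
    by (intro nn_integral_cong, subst nn_integral_lborel_scaleR[OF _ b]) simp_all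
  also have "\<dots> = ennreal (b ^ CARD('k)) * (\<integral>\<^sup>+x. (\<integral>\<^sup>+y. F (x, b *\<^sub>R y) \<partial>lborel) \<partial>lborel)"
    by (rule nn_integral_cmult) simp
  also have "\<dots> = ennreal (b ^ CARD('k)) * (ennreal (exp s ^ CARD('m)) *
      (\<integral>\<^sup>+x. (\<integral>\<^sup>+y. F (exp s *\<^sub>R x, b *\<^sub>R y) \<partial>lborel) \<partial>lborel))"
    by (subst nn_integral_lborel_scaleR[where c = "exp s"]) simp_all
  also have "(\<integral>\<^sup>+x. (\<integral>\<^sup>+y. F (exp s *\<^sub>R x, b *\<^sub>R y) \<partial>lborel) \<partial>lborel) = (\<integral>\<^sup>+z. F (dilation \<gamma> s z) \<partial>lborel)"
    by (subst nn_integral_lborel_pair, measurable) (simp add: dilation_def b_def)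
  also have "ennreal (b ^ CARD('k)) * (ennreal (exp s ^ CARD('m)) * X) =
     ennreal (exp ((real CARD('m) + (1 + \<gamma>) * real CARD('k)) * s)) * X" for X
  proof -
    have "b ^ CARD('k) * exp s ^ CARD('m) = exp ((real CARD('m) + (1 + \<gamma>) * real CARD('k)) * s)"
      by (simp add: b_def algebra_simps flip: exp_of_nat_mult exp_add)
    then show ?thesis
      using b by (simp add: mult.assoc[symmetric] ennreal_mult'[symmetric] less_imp_le)
  qed
  finally show ?thesis .
qed

text \<open>The Tonelli form of polar coordinates along the orbits of the dilations: each orbit meets the
  shell in a parameter interval of length one, so inserting the indicator of the shell and moving the
  dilation onto the integrand avoids any surface measure.\<close>

lemma nn_integral_polar:
  fixes F :: "(real^'m::finite) \<times> (real^'k::finite) \<Rightarrow> ennreal"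
  assumes g: "\<gamma> > 0" and [measurable]: "F \<in> borel_measurable borel"
  defines "Q \<equiv> real CARD('m) + (1 + \<gamma>) * real CARD('k)"
  shows "(\<integral>\<^sup>+z. F z \<partial>lborel) =
    (\<integral>\<^sup>+z\<in>{z. 1 \<le> gauge \<gamma> z \<and> gauge \<gamma> z < exp 1}.
       (\<integral>\<^sup>+s. ennreal (exp (Q * s)) * F (dilation \<gamma> s z) \<partial>lborel) \<partial>lborel)"
proof -
  define S :: "((real^'m) \<times> (real^'k)) set" where "S = {z. 1 \<le> gauge \<gamma> z \<and> gauge \<gamma> z < exp 1}"
  have [measurable]: "S \<in> sets borel" unfolding S_def by measurable
  \<comment> \<open>In the parameter \<open>s\<close> the gauge is
    \<open>exp (s + ln (gauge \<gamma> z))\<close>, so the orbit lies in the shell exactly while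
    \<open>s + ln (gauge \<gamma> z)\<close> runs through \<open>[0, 1)\<close>.\<close>
  have unit: "(\<integral>\<^sup>+s. indicator S (dilation \<gamma> s z) \<partial>lborel) = 1" if "fst z \<noteq> 0" for z
  proof -
    have p: "gauge \<gamma> z > 0" by (rule gauge_pos[OF that g])
    have "dilation \<gamma> s z \<in> S \<longleftrightarrow> s \<in> {- ln (gauge \<gamma> z) ..< 1 - ln (gauge \<gamma> z)}" for s
    proof -
      have "exp s * gauge \<gamma> z = exp (s + ln (gauge \<gamma> z))" using p by (simp add: exp_add)
      then show ?thesis
        using one_le_exp_iff[of "s + ln (gauge \<gamma> z)"] by (auto simp: S_def gauge_dilation[OF g])
    qed
    then have "(\<integral>\<^sup>+s. indicator S (dilation \<gamma> s z) \<partial>lborel)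
        = (\<integral>\<^sup>+s. indicator {- ln (gauge \<gamma> z) ..< 1 - ln (gauge \<gamma> z)} s \<partial>lborel)"
      by (intro nn_integral_cong) (simp add: indicator_def)
    then show ?thesis by simp
  qed
  have "(\<integral>\<^sup>+z. F z \<partial>lborel) = (\<integral>\<^sup>+z. \<integral>\<^sup>+s. F z * indicator S (dilation \<gamma> s z) \<partial>lborel \<partial>lborel)"
    by (rule nn_integral_cong_AE)
      (use AE_fst_nonzero in eventually_elim, simp add: nn_integral_cmult unit)
  also have "\<dots> = (\<integral>\<^sup>+s. \<integral>\<^sup>+z. F z * indicator S (dilation \<gamma> s z) \<partial>lborel \<partial>lborel)"
    by (rule lborel_pair.Fubini') measurable
  \<comment> \<open>For fixed \<open>s\<close> the substitution by
    \<open>dilation \<gamma> (- s)\<close> frees the indicator of the dilation, moves it onto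
    \<open>F\<close>, and costs the Jacobian. The reflection of \<open>s\<close> below restores the
    sign.\<close>
  also have "\<dots> = (\<integral>\<^sup>+s. \<integral>\<^sup>+z. ennreal (exp (- (Q * s))) * F (dilation \<gamma> (- s) z) * indicator S z \<partial>lborel \<partial>lborel)"
  proof (rule nn_integral_cong)
    fix s
    show "(\<integral>\<^sup>+z. F z * indicator S (dilation \<gamma> s z) \<partial>lborel)
        = (\<integral>\<^sup>+z. ennreal (exp (- (Q * s))) * F (dilation \<gamma> (- s) z) * indicator S z \<partial>lborel)"
      by (subst nn_integral_dilation[where \<gamma> = \<gamma> and s = "- s"])
        (simp_all add: dilation_dilation dilation_0 Q_def nn_integral_cmult[symmetric] mult.assoc)
  qed
  also have "\<dots> = (\<integral>\<^sup>+z. \<integral>\<^sup>+s. ennreal (exp (- (Q * s))) * F (dilation \<gamma> (- s) z) * indicator S z \<partial>lborel \<partial>lborel)"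
    by (rule lborel_pair.Fubini'[symmetric]) measurable
  also have "\<dots> = (\<integral>\<^sup>+z\<in>S. (\<integral>\<^sup>+s. ennreal (exp (Q * s)) * F (dilation \<gamma> s z) \<partial>lborel) \<partial>lborel)"
  proof (rule nn_integral_cong)
    fix z
    show "(\<integral>\<^sup>+s. ennreal (exp (- (Q * s))) * F (dilation \<gamma> (- s) z) * indicator S z \<partial>lborel)
        = (\<integral>\<^sup>+s. ennreal (exp (Q * s)) * F (dilation \<gamma> s z) \<partial>lborel) * indicator S z"
      by (subst (2) nn_integral_real_affine[where c = "-1" and t = 0])
        (simp_all add: nn_integral_multc)
  qed
  finally show ?thesis unfolding S_def .
qed

section \<open>Bounded sets and integrability of negative powers of the gauge\<close>

lemma bounded_gauge_le:
  fixes \<Omega> :: "((real^'m::finite) \<times> (real^'k::finite)) set"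
  assumes "bounded \<Omega>" "\<gamma> > 0"
  obtains R where "R > 0" and "\<And>z. z \<in> \<Omega> \<Longrightarrow> gauge \<gamma> z < R"
proof -
  from assms(1) obtain B where B: "B > 0" "\<And>z. z \<in> \<Omega> \<Longrightarrow> norm z \<le> B"
    by (auto simp: bounded_pos)
  define R where "R = (B powr (2*(1+\<gamma>)) + (1+\<gamma>)\<^sup>2 * B\<^sup>2) powr (1/(2*(1+\<gamma>)))"
  have le: "gauge \<gamma> z \<le> R" if "z \<in> \<Omega>" for z
  proof -
    have "norm (fst z) \<le> B" "norm (snd z) \<le> B"
      using norm_fst_le[of "fst z" "snd z"] norm_snd_le[of "snd z" "fst z"] B(2)[OF that] by auto
    then show ?thesis
      unfolding gauge_def R_def using assms(2) B(1)
      by (intro powr_mono2 add_mono mult_left_mono power_mono add_nonneg_nonneg) auto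
  qed
  have "R \<ge> 0" by (simp add: R_def)
  show ?thesis
  proof (rule that)
    \<comment> \<open>Adding one makes the bound strict and positive.\<close>
    show "R + 1 > 0" using \<open>R \<ge> 0\<close> by simp
    show "gauge \<gamma> z < R + 1" if "z \<in> \<Omega>" for z using le[OF that] by simp
  qed
qed

lemma emeasure_gauge_ball_finite:
  assumes g: "\<gamma> > 0"
  shows "emeasure lborel {z :: (real^'m::finite) \<times> (real^'k::finite). gauge \<gamma> z < R} < \<infinity>"
proof -
  have "{z :: (real^'m) \<times> (real^'k). gauge \<gamma> z < R} \<subseteq> cball 0 R \<times> cball 0 (R powr (1 + \<gamma>))"
  proof (clarify, intro conjI SigmaI)
    fix x :: "real^'m" and y :: "real^'k" assume l: "gauge \<gamma> (x, y) < R"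
    have R: "R \<ge> 0" using l gauge_nonneg[of \<gamma> "(x, y)"] by linarith
    have G: "norm x powr (2*(1+\<gamma>)) + (1+\<gamma>)\<^sup>2 * (norm y)\<^sup>2 \<le> R powr (2*(1+\<gamma>))"
    proof -
      have "gauge \<gamma> (x, y) powr (2*(1+\<gamma>)) \<le> R powr (2*(1+\<gamma>))"
        using l g by (intro powr_mono2) (simp_all add: gauge_nonneg)
      then show ?thesis by (simp only: gauge_powr[OF g] fst_conv snd_conv)
    qed
    have "norm x powr (2*(1+\<gamma>)) \<le> R powr (2*(1+\<gamma>))"
      by (rule order_trans[OF _ G]) simp
    then have "norm x \<le> R"
      using g R powr_less_mono2[of "2*(1+\<gamma>)" R "norm x"] by (force simp: not_le[symmetric])
    then show "x \<in> cball 0 R" by simp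
    have "(norm y)\<^sup>2 \<le> (1+\<gamma>)\<^sup>2 * (norm y)\<^sup>2"
      using mult_right_mono[of 1 "(1+\<gamma>)\<^sup>2" "(norm y)\<^sup>2"] g by (simp add: one_le_power)
    also have "\<dots> \<le> R powr (2*(1+\<gamma>))" by (rule order_trans[OF _ G]) simp
    also have "\<dots> = (R powr (1 + \<gamma>))\<^sup>2"
      by (simp add: power2_eq_square distrib_left flip: powr_add)
    finally have "norm y \<le> R powr (1 + \<gamma>)"
      by (rule power2_le_imp_le) simp
    then show "y \<in> cball 0 (R powr (1 + \<gamma>))" by simp
  qed
  then have "bounded {z :: (real^'m) \<times> (real^'k). gauge \<gamma> z < R}"
    by (rule bounded_subset[rotated]) (intro bounded_Times bounded_cball)
  then show ?thesis by (rule emeasure_bounded_finite)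
qed

lemma nn_integral_exp_Iio:
  fixes c L :: real
  assumes "c > 0"
  shows "(\<integral>\<^sup>+s\<in>{..<L}. ennreal (exp (c * s)) \<partial>lborel) < \<infinity>"
proof -
  have "(\<integral>\<^sup>+s\<in>{..<L}. ennreal (exp (c * s)) \<partial>lborel)
      = (\<integral>\<^sup>+s. ennreal (exp (- c * s)) * indicator {..<L} (- s) \<partial>lborel)"
    by (subst nn_integral_real_affine[where c = "-1" and t = 0]) simp_all
  also have "\<dots> \<le> (\<integral>\<^sup>+s. ennreal (exp (- c * s)) * indicator {- L..} s \<partial>lborel)"
    by (intro nn_integral_mono) (auto simp: indicator_def)
  also have "\<dots> = ennreal (0 - (- exp (- c * - L) / c))"
  proof (rule nn_integral_FTC_atLeast)
    show "DERIV (\<lambda>s. - exp (- c * s) / c) s :> exp (- c * s)" for s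
      using assms by (auto intro!: derivative_eq_intros)
    have "filterlim (\<lambda>s. - c * s) at_bot at_top"
      using assms by (intro filterlim_tendsto_neg_mult_at_bot[OF tendsto_const _ filterlim_ident]) simp
    from filterlim_compose[OF exp_at_bot this]
    have "((\<lambda>s. - exp (- c * s) / c) \<longlongrightarrow> - 0 / c) at_top"
      using assms by (intro tendsto_divide tendsto_minus tendsto_const) simp_all
    then show "((\<lambda>s. - exp (- c * s) / c) \<longlongrightarrow> 0) at_top" by simp
  qed simp_all
  finally show ?thesis by (rule le_less_trans) simp
qed

text \<open>In polar coordinates the inner integrand is at most \<open>exp ((Q - b) * s)\<close>,
  because the gauge is at least one on the shell and \<open>b \<ge> 0\<close>. It vanishes for
  \<open>s \<ge> ln R\<close>, so \<open>b < Q\<close> gives convergence at minus infinity,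
  uniformly over a shell of finite measure.\<close>

lemma nn_integral_gauge_powr_finite:
  fixes Q :: real and \<Omega> :: "((real^'m::finite) \<times> (real^'k::finite)) set"
  assumes g: "\<gamma> > 0" and R: "\<And>z. z \<in> \<Omega> \<Longrightarrow> gauge \<gamma> z < R" "R > 0"
    and [measurable]: "\<Omega> \<in> sets borel"
  defines "Q \<equiv> real CARD('m) + (1 + \<gamma>) * real CARD('k)"
  assumes b: "b < Q" "b \<ge> 0"
  shows "(\<integral>\<^sup>+z\<in>\<Omega>. ennreal (gauge \<gamma> z powr - b) \<partial>lborel) < \<infinity>"
proof -
  define S :: "((real^'m) \<times> (real^'k)) set" where "S = {z. 1 \<le> gauge \<gamma> z \<and> gauge \<gamma> z < exp 1}"
  have [measurable]: "S \<in> sets borel" unfolding S_def by measurable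
  define I where "I = (\<integral>\<^sup>+s\<in>{..<ln R}. ennreal (exp ((Q - b) * s)) \<partial>lborel)"
  have "(\<integral>\<^sup>+z\<in>\<Omega>. ennreal (gauge \<gamma> z powr - b) \<partial>lborel) =
    (\<integral>\<^sup>+z\<in>S. (\<integral>\<^sup>+s. ennreal (exp (Q * s)) * (ennreal (gauge \<gamma> (dilation \<gamma> s z) powr - b) *
       indicator \<Omega> (dilation \<gamma> s z)) \<partial>lborel) \<partial>lborel)"
    unfolding S_def Q_def by (rule nn_integral_polar[OF g]) measurable
  also have "\<dots> \<le> (\<integral>\<^sup>+z\<in>S. I \<partial>lborel)"
  proof (rule nn_integral_mono, unfold I_def)
    fix z
    have "ennreal (exp (Q * s)) * (ennreal (gauge \<gamma> (dilation \<gamma> s z) powr - b) * indicator \<Omega> (dilation \<gamma> s z))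
        \<le> ennreal (exp ((Q - b) * s)) * indicator {..<ln R} s" if "z \<in> S" for s
    proof (cases "dilation \<gamma> s z \<in> \<Omega>")
      case True
      have z: "1 \<le> gauge \<gamma> z" using that by (simp add: S_def)
      have "exp s \<le> exp s * gauge \<gamma> z" using z by simp
      also have "\<dots> < R" using R(1)[OF True] by (simp add: gauge_dilation[OF g])
      finally have s: "s < ln R" by (metis exp_less_cancel_iff exp_ln R(2))
      have "gauge \<gamma> (dilation \<gamma> s z) powr - b = exp (- b * s) * gauge \<gamma> z powr - b"
        using z by (simp add: gauge_dilation[OF g] powr_mult exp_powr_real mult.commute)
      also have "\<dots> \<le> exp (- b * s) * 1"
        using z b(2) powr_mono[of "- b" 0 "gauge \<gamma> z"] by (intro mult_left_mono) auto
      finally have "exp (Q * s) * gauge \<gamma> (dilation \<gamma> s z) powr - b \<le> exp ((Q - b) * s)"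
        by (simp add: left_diff_distrib exp_diff exp_minus field_simps)
      then show ?thesis using s True by (simp add: ennreal_mult[symmetric])
    qed simp
    then show "(\<integral>\<^sup>+s. ennreal (exp (Q * s)) * (ennreal (gauge \<gamma> (dilation \<gamma> s z) powr - b) *
       indicator \<Omega> (dilation \<gamma> s z)) \<partial>lborel) * indicator S z
      \<le> (\<integral>\<^sup>+s\<in>{..<ln R}. ennreal (exp ((Q - b) * s)) \<partial>lborel) * indicator S z"
      by (auto simp: indicator_def intro!: nn_integral_mono)
  qed
  also have "\<dots> = I * emeasure lborel S"
    by (rule nn_integral_cmult_indicator) simp
  also have "\<dots> < \<infinity>"
  proof -
    have "emeasure lborel S \<le> emeasure lborel {z :: (real^'m) \<times> (real^'k). gauge \<gamma> z < exp 1}"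
      by (rule emeasure_mono) (auto simp: S_def)
    also have "\<dots> < \<infinity>" by (rule emeasure_gauge_ball_finite[OF g])
    finally have "emeasure lborel S < \<infinity>" .
    moreover have "I < \<infinity>" unfolding I_def using b(1) by (intro nn_integral_exp_Iio) simp
    ultimately show ?thesis by (simp add: ennreal_mult_less_top)
  qed
  finally show ?thesis .
qed

section \<open>One-dimensional and general inequalities\<close>

text \<open>An exact derivative contributes only boundary terms, and these vanish in the limit. The
  form with nonnegative integrals presupposes no integrability: if \<open>F1\<close> has infinite
  integral there is nothing to show, and otherwise the claim follows from the intervals
  \<open>[-n, n]\<close> by monotone convergence.\<close>

lemma nn_integral_le_of_exact_derivative:
  fixes F1 F2 G G' :: "real \<Rightarrow> real"
  assumes [measurable]: "F1 \<in> borel_measurable borel" "F2 \<in> borel_measurable borel"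
    and pos: "\<And>s. 0 \<le> F1 s" "\<And>s. 0 \<le> F2 s"
    and le: "\<And>s. F2 s + G' s \<le> F1 s"
    and G: "\<And>s. (G has_real_derivative G' s) (at s)" and G': "continuous_on UNIV G'"
    and lim: "(G \<longlongrightarrow> 0) at_bot" "(G \<longlongrightarrow> 0) at_top"
  shows "(\<integral>\<^sup>+s. ennreal (F2 s) \<partial>lborel) \<le> (\<integral>\<^sup>+s. ennreal (F1 s) \<partial>lborel)"
proof (cases "(\<integral>\<^sup>+s. ennreal (F1 s) \<partial>lborel) = \<infinity>")
  case False
  then have int1: "integrable lborel F1"
    using pos by (intro integrableI_nonneg) (auto simp: less_top)
  have eq1: "(\<integral>\<^sup>+s. ennreal (F1 s) \<partial>lborel) = ennreal (\<integral>s. F1 s \<partial>lborel)"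
    using int1 pos by (intro nn_integral_eq_integral) auto
  define I where "I n = {- real n .. real n}" for n
  have [measurable]: "I n \<in> sets borel" for n by (simp add: I_def)
  have bound: "(\<integral>\<^sup>+s. ennreal (F2 s * indicator (I n) s) \<partial>lborel)
      \<le> ennreal ((\<integral>s. F1 s \<partial>lborel) + (G (- real n) - G (real n)))" for n
  proof -
    have hG: "has_bochner_integral lborel (\<lambda>s. G' s * indicator (I n) s) (G (real n) - G (- real n))"
      unfolding I_def using G' by (intro has_bochner_integral_FTC_Icc_real G)
        (auto simp: continuous_on_eq_continuous_at)
    have i1: "integrable lborel (\<lambda>s. F1 s * indicator (I n) s)"
      by (rule Bochner_Integration.integrable_bound[OF int1]) (auto simp: indicator_def)
    \<comment> \<open>Integrability of \<open>F2\<close> on the interval is not given; it comes from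
      the domination \<open>F2 \<le> F1 - G'\<close>.\<close>
    have i2: "integrable lborel (\<lambda>s. F2 s * indicator (I n) s)"
    proof (rule Bochner_Integration.integrable_bound)
      show "integrable lborel (\<lambda>s. F1 s * indicator (I n) s - G' s * indicator (I n) s)"
        using i1 hG by (intro Bochner_Integration.integrable_diff) (auto simp: has_bochner_integral_iff)
      have "norm (F2 s * indicator (I n) s) \<le> norm (F1 s * indicator (I n) s - G' s * indicator (I n) s)" for s
        using le[of s] pos[of s] by (auto simp: indicator_def)
      then show "AE s in lborel. norm (F2 s * indicator (I n) s)
          \<le> norm (F1 s * indicator (I n) s - G' s * indicator (I n) s)" by simp
    qed simp
    have "(\<integral>s. F2 s * indicator (I n) s \<partial>lborel)
        \<le> (\<integral>s. F1 s * indicator (I n) s - G' s * indicator (I n) s \<partial>lborel)"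
      using i1 i2 hG le by (intro integral_mono Bochner_Integration.integrable_diff)
        (auto simp: has_bochner_integral_iff indicator_def algebra_simps)
    also have "\<dots> = (\<integral>s. F1 s * indicator (I n) s \<partial>lborel) - (G (real n) - G (- real n))"
      using i1 hG by (subst Bochner_Integration.integral_diff) (auto simp: has_bochner_integral_iff)
    also have "(\<integral>s. F1 s * indicator (I n) s \<partial>lborel) \<le> (\<integral>s. F1 s \<partial>lborel)"
      using i1 int1 pos by (intro integral_mono) (auto simp: indicator_def)
    finally have "(\<integral>s. F2 s * indicator (I n) s \<partial>lborel) \<le> (\<integral>s. F1 s \<partial>lborel) + (G (- real n) - G (real n))"
      by simp
    moreover have "(\<integral>\<^sup>+s. ennreal (F2 s * indicator (I n) s) \<partial>lborel)
        = ennreal (\<integral>s. F2 s * indicator (I n) s \<partial>lborel)"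
      using i2 pos by (intro nn_integral_eq_integral) auto
    ultimately show ?thesis by (simp add: ennreal_leI)
  qed
  have inc: "incseq (\<lambda>n s. ennreal (F2 s * indicator (I n) s))"
    using pos by (auto simp: incseq_def le_fun_def I_def indicator_def intro!: ennreal_leI)
  have "(\<lambda>n. \<integral>\<^sup>+s. ennreal (F2 s * indicator (I n) s) \<partial>lborel) \<longlonglongrightarrow> (\<integral>\<^sup>+s. ennreal (F2 s) \<partial>lborel)"
  proof (rule nn_integral_LIMSEQ[OF inc])
    fix s
    have "eventually (\<lambda>n. ennreal (F2 s * indicator (I n) s) = ennreal (F2 s)) sequentially"
      using eventually_ge_at_top[of "nat \<lceil>\<bar>s\<bar>\<rceil>"]
      by eventually_elim (auto simp: I_def indicator_def le_nat_iff; linarith)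
    then show "(\<lambda>n. ennreal (F2 s * indicator (I n) s)) \<longlonglongrightarrow> ennreal (F2 s)"
      by (rule tendsto_eventually)
  qed simp
  moreover have "(\<lambda>n. ennreal ((\<integral>s. F1 s \<partial>lborel) + (G (- real n) - G (real n))))
      \<longlonglongrightarrow> ennreal ((\<integral>s. F1 s \<partial>lborel) + (0 - 0))"
  proof (intro tendsto_ennrealI tendsto_add tendsto_diff tendsto_const)
    show "(\<lambda>n. G (- real n)) \<longlonglongrightarrow> 0"
      by (rule filterlim_compose[OF lim(1)])
        (rule filterlim_compose[OF filterlim_uminus_at_bot_at_top filterlim_real_sequentially])
    show "(\<lambda>n. G (real n)) \<longlonglongrightarrow> 0"
      by (rule filterlim_compose[OF lim(2) filterlim_real_sequentially])
  qed
  ultimately show ?thesis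
    unfolding eq1 using bound by (auto intro: LIMSEQ_le)
qed simp

text \<open>Here \<open>E\<close> stands for \<open>\<rho>^\<epsilon>\<close> on an orbit,
  \<open>f\<close> for the function and \<open>X\<close> for its derivative. Since
  \<open>E' = \<epsilon> E\<close>, the subtracted bracket is \<open>exp (- a s)\<close> times the
  derivative of \<open>exp (a s) * (a/2 + \<delta> E) * f^2\<close>.\<close>

lemma hardy_pointwise:
  fixes a \<epsilon> E0 :: real
  assumes "a > 0" "\<epsilon> > 0" "E0 > 0"
  obtains K \<delta> where "K > 0" "\<delta> > 0" "K * E0 \<le> 1"
    "\<And>E f X. 0 \<le> E \<Longrightarrow> E \<le> E0 \<Longrightarrow>
      (a/2)\<^sup>2 * f\<^sup>2 - ((a * (a/2 + \<delta> * E) + \<epsilon> * \<delta> * E) * f\<^sup>2 + 2 * (a/2 + \<delta> * E) * f * X) \<le> (1 - K * E) * X\<^sup>2"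
proof -
  \<comment> \<open>This choice keeps \<open>\<delta> E \<le> \<epsilon> / 2\<close> for
    \<open>E \<le> E0\<close>, so the quadratic loss in \<open>\<delta>\<close> uses at most half of
    the linear gain \<open>\<epsilon> \<delta> E\<close>.\<close>
  define \<delta> where "\<delta> = \<epsilon> / (2 * E0)"
  \<comment> \<open>\<open>P\<close> is the largest value of \<open>a/2 + \<delta> E\<close>,
    attained at \<open>E = E0\<close>.\<close>
  define P where "P = (a + \<epsilon>) / 2"
  \<comment> \<open>The first entry lets the square \<open>Y^2\<close> absorb its share of
    \<open>K E X^2\<close>, the second lets the remaining \<open>f^2\<close> term absorb the other
    share.\<close>
  define K where "K = min (1 / (2 * E0)) (\<delta> * \<epsilon> / (4 * P\<^sup>2))"
  have P: "P > 0" and d: "\<delta> > 0" using assms by (simp_all add: P_def \<delta>_def)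
  have K: "K > 0" using assms P d by (simp add: K_def)
  have K1: "2 * (K * E0) \<le> 1"
  proof -
    have "K \<le> 1 / (2 * E0)" by (simp add: K_def)
    then show ?thesis using assms by (simp add: field_simps)
  qed
  have K2: "2 * (K * P\<^sup>2) \<le> \<delta> * \<epsilon> / 2"
  proof -
    have "K \<le> \<delta> * \<epsilon> / (4 * P\<^sup>2)" by (simp add: K_def)
    then show ?thesis using P by (simp add: field_simps)
  qed
  show ?thesis
  proof (rule that)
    show "K > 0" "\<delta> > 0" by fact+
    show "K * E0 \<le> 1" using K1 by linarith
    fix E f X :: real assume E: "0 \<le> E" "E \<le> E0"
    define p where "p = a/2 + \<delta> * E"
    define Y where "Y = X + p * f"
    have dE: "\<delta> * E \<le> \<epsilon> / 2"
    proof -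
      have "\<delta> * E \<le> \<delta> * E0" using d E by (intro mult_left_mono) auto
      also have "\<dots> = \<epsilon> / 2" using assms by (simp add: \<delta>_def)
      finally show ?thesis .
    qed
    have p: "0 \<le> p" "p \<le> P" using dE E d assms by (simp_all add: p_def P_def add_divide_distrib)
    \<comment> \<open>Completing the square with \<open>p = a/2 + \<delta> E\<close> leaves
      \<open>\<epsilon> \<delta> E - (p - a/2)^2\<close> as the coefficient of \<open>f^2\<close>,
      which is \<open>E \<delta> (\<epsilon> - \<delta> E)\<close>.\<close>
    have "(1 - K * E) * X\<^sup>2 - ((a/2)\<^sup>2 * f\<^sup>2 - ((a * (a/2 + \<delta> * E) + \<epsilon> * \<delta> * E) * f\<^sup>2 + 2 * (a/2 + \<delta> * E) * f * X))
        = Y\<^sup>2 - K * E * X\<^sup>2 + E * \<delta> * (\<epsilon> - \<delta> * E) * f\<^sup>2"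
      by (simp add: Y_def p_def power2_eq_square field_simps)
    moreover have "E * \<delta> * (\<epsilon> / 2) * f\<^sup>2 \<le> E * \<delta> * (\<epsilon> - \<delta> * E) * f\<^sup>2"
      using dE E d by (intro mult_right_mono mult_left_mono) auto
    moreover have "K * E * X\<^sup>2 \<le> Y\<^sup>2 + E * \<delta> * (\<epsilon> / 2) * f\<^sup>2"
    proof -
      \<comment> \<open>As \<open>X = Y - p f\<close>, this square is exactly the difference
        \<open>2 Y^2 + 2 p^2 f^2 - X^2\<close>.\<close>
      have "0 \<le> (Y + p * f)\<^sup>2" by simp
      then have "X\<^sup>2 \<le> 2 * Y\<^sup>2 + 2 * (p\<^sup>2 * f\<^sup>2)"
        by (simp add: Y_def power2_eq_square algebra_simps)
      also have "\<dots> \<le> 2 * Y\<^sup>2 + 2 * (P\<^sup>2 * f\<^sup>2)"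
        using p by (intro add_left_mono mult_left_mono mult_right_mono power_mono) auto
      finally have "K * E * X\<^sup>2 \<le> K * E * (2 * Y\<^sup>2 + 2 * (P\<^sup>2 * f\<^sup>2))"
        using K E by (intro mult_left_mono) auto
      also have "\<dots> = 2 * (K * E) * Y\<^sup>2 + E * (2 * (K * P\<^sup>2)) * f\<^sup>2"
        by (simp add: algebra_simps)
      also have "\<dots> \<le> 1 * Y\<^sup>2 + E * (\<delta> * \<epsilon> / 2) * f\<^sup>2"
      proof (intro add_mono mult_right_mono mult_left_mono)
        have "K * E \<le> K * E0" using K E by (intro mult_left_mono) auto
        then show "2 * (K * E) \<le> 1" using K1 by linarith
      qed (use K2 E in auto)
      finally show ?thesis by simp
    qed
    ultimately show "(a/2)\<^sup>2 * f\<^sup>2 - ((a * (a/2 + \<delta> * E) + \<epsilon> * \<delta> * E) * f\<^sup>2 + 2 * (a/2 + \<delta> * E) * f * X) \<le> (1 - K * E) * X\<^sup>2"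
      by linarith
  qed
qed

text \<open>Hoelder's inequality with exponents \<open>1/\<theta>\<close> and
  \<open>1/(1-\<theta>)\<close>, raised to the power \<open>1/\<theta>\<close> so that the integral
  of \<open>X\<close> appears linearly. Only a positive bound \<open>J\<close> for the integral of
  \<open>Y\<close> enters, so dividing by it is safe.\<close>

lemma Holder_ennreal_powr:
  fixes X Y :: "'a \<Rightarrow> real" and \<theta> J :: real
  assumes [measurable]: "X \<in> borel_measurable M" "Y \<in> borel_measurable M"
    and pos: "\<And>z. 0 \<le> X z" "\<And>z. 0 \<le> Y z" and th: "0 < \<theta>" "\<theta> < 1"
    and J: "(\<integral>\<^sup>+z. ennreal (Y z) \<partial>M) \<le> ennreal J" "J > 0"
  shows "ennreal_powr (\<integral>\<^sup>+z. ennreal (X z powr \<theta> * Y z powr (1 - \<theta>)) \<partial>M) (1 / \<theta>)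
     \<le> ennreal (J powr ((1 - \<theta>) / \<theta>)) * (\<integral>\<^sup>+z. ennreal (X z) \<partial>M)"
proof (cases "(\<integral>\<^sup>+z. ennreal (X z) \<partial>M)")
  case top
  then show ?thesis using J by (simp add: ennreal_mult_top)
next
  case (real m)
  show ?thesis
  \<comment> \<open>Young's inequality is applied to \<open>X / m\<close>, hence the separate
    treatment of a vanishing integral.\<close>
  proof (cases "m = 0")
    case True
    then have "AE z in M. ennreal (X z) = 0"
      using real by (simp add: nn_integral_0_iff_AE)
    then have "AE z in M. X z = 0"
      by eventually_elim (use pos in \<open>simp add: ennreal_eq_0_iff order.antisym\<close>)
    then have "AE z in M. ennreal (X z powr \<theta> * Y z powr (1 - \<theta>)) = 0"
      by eventually_elim simp
    then have "(\<integral>\<^sup>+z. ennreal (X z powr \<theta> * Y z powr (1 - \<theta>)) \<partial>M) = 0"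
      by (subst nn_integral_0_iff_AE) auto
    then show ?thesis by (simp add: ennreal_powr_def)
  next
    case False
    then have m: "m > 0" using real by simp
    \<comment> \<open>This is the Hoelder bound itself: Young's inequality for the normalised
      functions is multiplied by \<open>c\<close>, and after integration the weights
      \<open>\<theta>\<close> and \<open>1 - \<theta>\<close> add up to one.\<close>
    define c where "c = m powr \<theta> * J powr (1 - \<theta>)"
    have c: "c > 0" using m J by (simp add: c_def)
    have "X z powr \<theta> * Y z powr (1 - \<theta>) \<le> c * \<theta> / m * X z + c * (1 - \<theta>) / J * Y z" for z
    proof -
      have "(X z / m) powr \<theta> * (Y z / J) powr (1 - \<theta>) \<le> \<theta> * (X z / m) + (1 - \<theta>) * (Y z / J)"
      proof (cases "X z = 0 \<or> Y z = 0")
        case False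
        then have "X z > 0" "Y z > 0" using pos[of z] by auto
        then show ?thesis using m J th by (intro Youngs_inequality_0) auto
      qed (use pos m J th in auto)
      then have "c * ((X z / m) powr \<theta> * (Y z / J) powr (1 - \<theta>)) \<le> c * (\<theta> * (X z / m) + (1 - \<theta>) * (Y z / J))"
        using c by (intro mult_left_mono) auto
      then show ?thesis
        using pos m J by (simp add: c_def powr_divide algebra_simps)
    qed
    then have "(\<integral>\<^sup>+z. ennreal (X z powr \<theta> * Y z powr (1 - \<theta>)) \<partial>M)
       \<le> (\<integral>\<^sup>+z. ennreal (c * \<theta> / m) * ennreal (X z) + ennreal (c * (1 - \<theta>) / J) * ennreal (Y z) \<partial>M)"
      using c m J th pos by (intro nn_integral_mono)
        (simp add: ennreal_mult[symmetric] ennreal_plus[symmetric] del: ennreal_plus)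
    also have "\<dots> = ennreal (c * \<theta> / m) * ennreal m + ennreal (c * (1 - \<theta>) / J) * (\<integral>\<^sup>+z. ennreal (Y z) \<partial>M)"
      by (simp add: nn_integral_add nn_integral_cmult real)
    also have "\<dots> \<le> ennreal (c * \<theta> / m) * ennreal m + ennreal (c * (1 - \<theta>) / J) * ennreal J"
      using J by (intro add_left_mono mult_left_mono) auto
    also have "\<dots> = ennreal (c * \<theta> / m * m + c * (1 - \<theta>) / J * J)"
      using c m J th by (simp add: ennreal_mult[symmetric] ennreal_plus[symmetric] del: ennreal_plus)
    also have "c * \<theta> / m * m + c * (1 - \<theta>) / J * J = c"
      using m J by (simp add: field_simps)
    finally have le: "(\<integral>\<^sup>+z. ennreal (X z powr \<theta> * Y z powr (1 - \<theta>)) \<partial>M) \<le> ennreal c" .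
    then have fin: "(\<integral>\<^sup>+z. ennreal (X z powr \<theta> * Y z powr (1 - \<theta>)) \<partial>M) \<noteq> \<infinity>"
      by (auto simp: top_unique)
    define B where "B = enn2real (\<integral>\<^sup>+z. ennreal (X z powr \<theta> * Y z powr (1 - \<theta>)) \<partial>M)"
    have "B \<le> c" using le c unfolding B_def by (simp add: enn2real_leI)
    then have "B powr (1 / \<theta>) \<le> c powr (1 / \<theta>)"
      using th by (intro powr_mono2) (auto simp: B_def)
    also have "\<dots> = J powr ((1 - \<theta>) / \<theta>) * m"
      using th m J by (simp add: c_def powr_mult powr_powr)
    finally show ?thesis
      using fin m by (simp add: ennreal_powr_def B_def real ennreal_mult[symmetric] ennreal_leI)
  qed
qed

section \<open>Test functions along an orbit\<close>

lemma test_fun_differentiable: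
  assumes "test_fun \<Omega> \<phi>"
  shows "\<phi> differentiable (at z)"
  using assms dirderiv.simps(1)[of \<phi>] unfolding test_fun_def smooth_on_def by (metis UNIV_I)

text \<open>Smoothness includes differentiability of the directional derivative for the one-element
  list \<open>[v]\<close>, hence its continuity.\<close>

lemma test_fun_continuous_derivative:
  assumes "test_fun \<Omega> \<phi>"
  shows "continuous_on UNIV (\<lambda>z. frechet_derivative \<phi> (at z) v)"
proof -
  have "dirderiv [v] \<phi> differentiable (at z)" for z
    using assms unfolding test_fun_def smooth_on_def by blast
  then have "(\<lambda>z. frechet_derivative \<phi> (at z) v) differentiable (at z)" for z
    by simp
  then show ?thesis
    by (intro continuous_at_imp_continuous_on ballI differentiable_imp_continuous_within)
qed

lemma test_fun_outside:
  assumes "test_fun \<Omega> \<phi>" and "z \<notin> \<Omega>"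
  shows "\<phi> z = 0" and "frechet_derivative \<phi> (at z) = (\<lambda>_. 0)"
proof -
  \<comment> \<open>The complement of the closed support is an open neighbourhood of
    \<open>z\<close>, so vanishing passes to the derivative.\<close>
  define U where "U = - closure {z. \<phi> z \<noteq> 0}"
  have U: "open U" "z \<in> U" using assms by (auto simp: U_def test_fun_def)
  have zero: "\<phi> w = 0" if "w \<in> U" for w
    using that closure_subset[of "{z. \<phi> z \<noteq> 0}"] by (auto simp: U_def)
  show "\<phi> z = 0" using zero U by blast
  have "(\<phi> has_derivative (\<lambda>_. 0)) (at z)"
    by (rule has_derivative_transform_within_open[OF has_derivative_const U]) (simp add: zero)
  then show "frechet_derivative \<phi> (at z) = (\<lambda>_. 0)"
    by (rule frechet_derivative_at[symmetric])
qed

lemma test_fun_grad_norm_outside: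
  assumes "test_fun \<Omega> \<phi>" and "z \<notin> \<Omega>"
  shows "grushin_grad_norm \<gamma> \<phi> z = 0"
  by (simp add: grushin_grad_norm_def test_fun_outside[OF assms])

lemma measurable_grushin_grad_norm:
  assumes "test_fun \<Omega> \<phi>"
  shows "grushin_grad_norm \<gamma> \<phi> \<in> borel_measurable borel"
proof -
  have [measurable]: "(\<lambda>z. frechet_derivative \<phi> (at z) v) \<in> borel_measurable borel" for v
    by (intro borel_measurable_continuous_onI test_fun_continuous_derivative[OF assms])
  have [measurable]: "(\<lambda>z::(real^'a) \<times> (real^'b). norm (fst z)) \<in> borel_measurable borel"
    by (intro borel_measurable_continuous_onI continuous_intros)
  show ?thesis unfolding grushin_grad_norm_def[abs_def] by simp
qed

lemma has_real_derivative_orbit: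
  fixes \<phi> :: "(real^'m::finite) \<times> (real^'k::finite) \<Rightarrow> real"
  assumes "\<phi> differentiable (at (dilation \<gamma> s z))"
  shows "((\<lambda>s. \<phi> (dilation \<gamma> s z)) has_real_derivative
    frechet_derivative \<phi> (at (dilation \<gamma> s z))
      (fst (dilation \<gamma> s z), (1 + \<gamma>) *\<^sub>R snd (dilation \<gamma> s z))) (at s)"
proof -
  let ?D = "frechet_derivative \<phi> (at (dilation \<gamma> s z))"
  let ?v = "(fst (dilation \<gamma> s z), (1 + \<gamma>) *\<^sub>R snd (dilation \<gamma> s z))"
  have "(exp has_derivative (*) (exp s)) (at s)"
    using DERIV_exp[of s] by (simp add: has_field_derivative_def)
  moreover have "((\<lambda>s. exp ((1 + \<gamma>) * s)) has_derivative (*) (exp ((1 + \<gamma>) * s) * (1 + \<gamma>))) (at s)"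
    unfolding has_field_derivative_def[symmetric] by (auto intro!: derivative_eq_intros)
  ultimately have "((\<lambda>s. dilation \<gamma> s z) has_derivative
      (\<lambda>h. ((exp s * h) *\<^sub>R fst z, (exp ((1 + \<gamma>) * s) * (1 + \<gamma>) * h) *\<^sub>R snd z))) (at s)"
    unfolding dilation_def by (intro has_derivative_Pair has_derivative_scaleR_left)
  \<comment> \<open>The velocity of the orbit depends only on the current point, where it is the
    generator of the dilations.\<close>
  also have "(\<lambda>h. ((exp s * h) *\<^sub>R fst z, (exp ((1 + \<gamma>) * s) * (1 + \<gamma>) * h) *\<^sub>R snd z)) = (\<lambda>h. h *\<^sub>R ?v)"
    by (simp add: dilation_def fun_eq_iff mult_ac)
  finally have "((\<lambda>s. dilation \<gamma> s z) has_derivative (\<lambda>h. h *\<^sub>R ?v)) (at s)" .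
  moreover have "(\<phi> has_derivative ?D) (at (dilation \<gamma> s z))"
    using assms frechet_derivative_works by blast
  ultimately have "((\<lambda>s. \<phi> (dilation \<gamma> s z)) has_derivative (\<lambda>h. ?D (h *\<^sub>R ?v))) (at s)"
    by (rule has_derivative_compose)
  also have "(\<lambda>h. ?D (h *\<^sub>R ?v)) = (\<lambda>h. ?D ?v * h)"
    using linear_frechet_derivative[OF assms] by (simp only: linear_scale) (simp add: mult.commute)
  finally show ?thesis by (simp add: has_field_derivative_def)
qed

text \<open>The direction moves with \<open>s\<close>, while continuity is known for fixed
  directions; expanding in the coordinate directions separates the two dependences.\<close>

lemma continuous_on_orbit_derivative:
  fixes \<phi> :: "(real^'m::finite) \<times> (real^'k::finite) \<Rightarrow> real"
  assumes "test_fun \<Omega> \<phi>"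
  shows "continuous_on UNIV (\<lambda>s. frechet_derivative \<phi> (at (dilation \<gamma> s z))
      (fst (dilation \<gamma> s z), (1 + \<gamma>) *\<^sub>R snd (dilation \<gamma> s z)))"
proof -
  have "continuous_on UNIV (\<lambda>s. frechet_derivative \<phi> (at (dilation \<gamma> s z)) v)" for v
    by (rule continuous_on_compose2[OF test_fun_continuous_derivative[OF assms]])
      (auto intro!: continuous_intros)
  then show ?thesis
    by (subst frechet_derivative_pair_expand[OF test_fun_differentiable[OF assms]])
      (auto intro!: continuous_intros)
qed

lemma dilation_tendsto_0:
  fixes z :: "'a::real_normed_vector \<times> 'b::real_normed_vector"
  assumes "\<gamma> > 0"
  shows "((\<lambda>s. dilation \<gamma> s z) \<longlongrightarrow> 0) at_bot"
proof -
  have "filterlim (\<lambda>s. (1 + \<gamma>) * s) at_bot at_bot"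
    using assms by (intro filterlim_tendsto_pos_mult_at_bot[OF tendsto_const _ filterlim_ident]) simp
  from filterlim_compose[OF exp_at_bot this]
  have "((\<lambda>s. (exp s *\<^sub>R fst z, exp ((1 + \<gamma>) * s) *\<^sub>R snd z)) \<longlongrightarrow> (0 *\<^sub>R fst z, 0 *\<^sub>R snd z)) at_bot"
    by (intro tendsto_Pair tendsto_scaleR tendsto_const exp_at_bot)
  then show ?thesis by (simp add: dilation_def zero_prod_def)
qed

text \<open>Along one orbit the slope is constant and the gauge is exponential, so the weights
  reduce to \<open>exp (a * s)\<close> times a constant and the pointwise inequality can be
  integrated in \<open>s\<close>. The constants \<open>K\<close> and \<open>\<delta>\<close> are
  parameters so that they are the same for all orbits and all \<open>\<phi>\<close>.\<close>

lemma orbit_hardy: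
  fixes \<phi> :: "(real^'m::finite) \<times> (real^'k::finite) \<Rightarrow> real" and z :: "(real^'m::finite) \<times> (real^'k::finite)"
    and a \<alpha> \<gamma> t Q \<epsilon> R K \<delta> :: real
  assumes g: "\<gamma> > 0" and z: "fst z \<noteq> 0" and phi: "test_fun \<Omega> \<phi>"
    and R: "\<And>w. w \<in> \<Omega> \<Longrightarrow> gauge \<gamma> w < R"
    and a: "a > 0" "a = Q + \<alpha> - 2" and eps: "\<epsilon> > 0"
    and K: "K > 0" "\<delta> > 0" "K * R powr \<epsilon> \<le> 1"
    and hardy: "\<And>E f X. 0 \<le> E \<Longrightarrow> E \<le> R powr \<epsilon> \<Longrightarrow>
      (a/2)\<^sup>2 * f\<^sup>2 - ((a * (a/2 + \<delta> * E) + \<epsilon> * \<delta> * E) * f\<^sup>2 + 2 * (a/2 + \<delta> * E) * f * X) \<le> (1 - K * E) * X\<^sup>2"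
  defines "W \<equiv> \<lambda>w. gauge \<gamma> w powr \<alpha> * gauge_slope \<gamma> w powr t"
  defines "H \<equiv> \<lambda>w. gauge \<gamma> w powr \<alpha> * gauge_slope \<gamma> w powr (t + 2) / (gauge \<gamma> w)\<^sup>2"
  shows "(\<integral>\<^sup>+s. ennreal (exp (Q * s) * ((a/2)\<^sup>2 * (H (dilation \<gamma> s z) * (\<phi> (dilation \<gamma> s z))\<^sup>2)
           + K * (W (dilation \<gamma> s z) * gauge \<gamma> (dilation \<gamma> s z) powr \<epsilon>
              * (grushin_grad_norm \<gamma> \<phi> (dilation \<gamma> s z))\<^sup>2))) \<partial>lborel)
     \<le> (\<integral>\<^sup>+s. ennreal (exp (Q * s) * (W (dilation \<gamma> s z) * (grushin_grad_norm \<gamma> \<phi> (dilation \<gamma> s z))\<^sup>2)) \<partial>lborel)"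
proof -
  define d where "d s = dilation \<gamma> s z" for s
  define r where "r = gauge \<gamma> z"
  have r: "r > 0" unfolding r_def by (rule gauge_pos[OF z g])
  have gd: "gauge \<gamma> (d s) = exp s * r" for s by (simp add: d_def r_def gauge_dilation[OF g])
  have fd: "fst (d s) \<noteq> 0" for s using z by (simp add: d_def dilation_def)
  have diff: "\<phi> differentiable (at w)" for w by (rule test_fun_differentiable[OF phi])
  define f where "f s = \<phi> (d s)" for s
  define X where "X s = frechet_derivative \<phi> (at (d s)) (fst (d s), (1 + \<gamma>) *\<^sub>R snd (d s))" for s
  define N where "N s = grushin_grad_norm \<gamma> \<phi> (d s)" for s
  define E where "E s = (exp s * r) powr \<epsilon>" for s
  have E_eq: "E s = exp (\<epsilon> * s) * r powr \<epsilon>" for s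
    using r by (simp add: E_def powr_mult exp_powr_real mult.commute)
  define h where "h = H z"
  have h: "h \<ge> 0" by (simp add: h_def H_def)
  \<comment> \<open>The exponents \<open>Q\<close> from the Jacobian, \<open>\<alpha>\<close> from
    the weight and \<open>-2\<close> from the Hardy denominator add up to \<open>a\<close>.\<close>
  have Hd: "exp (Q * s) * H (d s) = exp (a * s) * h" for s
  proof -
    have "H (d s) = exp (\<alpha> * s) * h / (exp s)\<^sup>2"
      using r by (simp add: H_def gd h_def r_def[symmetric] powr_mult exp_powr_real
          d_def gauge_slope_dilation[OF g] gd[unfolded d_def] power_mult_distrib mult_ac)
    moreover have "exp (a * s) = exp (Q * s) * exp (\<alpha> * s) / (exp s)\<^sup>2"
      by (simp add: a(2) algebra_simps exp_diff exp_add flip: exp_double)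
    ultimately show ?thesis by simp
  qed
  \<comment> \<open>The two extra powers of the slope in \<open>H\<close>, together with
    \<open>1 / \<rho>^2\<close>, are the factor in the bound of the radial derivative.\<close>
  have WN: "H (d s) * (X s)\<^sup>2 \<le> W (d s) * (N s)\<^sup>2" for s
  proof -
    have "gauge_slope \<gamma> (d s) > 0" using gauge_pos[OF fd[of s] g] fd[of s] by (simp add: gauge_slope_def)
    then have "H (d s) = W (d s) * ((gauge_slope \<gamma> (d s))\<^sup>2 / (gauge \<gamma> (d s))\<^sup>2)"
      by (simp add: H_def W_def powr_add)
    then have "H (d s) * (X s)\<^sup>2 = W (d s) * ((gauge_slope \<gamma> (d s))\<^sup>2 / (gauge \<gamma> (d s))\<^sup>2 * (X s)\<^sup>2)"
      by simp
    also have "\<dots> \<le> W (d s) * (N s)\<^sup>2"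
      unfolding X_def N_def
      by (intro mult_left_mono radial_derivative_bound[OF g fd diff]) (simp add: W_def)
    finally show ?thesis .
  qed
  define p where "p s = a/2 + \<delta> * E s" for s
  define G where "G s = - (h * exp (a * s) * p s * (f s)\<^sup>2)" for s
  define G' where "G' s = - (h * exp (a * s) * ((a * p s + \<epsilon> * \<delta> * E s) * (f s)\<^sup>2 + 2 * p s * f s * X s))" for s
  have f': "(f has_real_derivative X s) (at s)" for s
    unfolding f_def X_def d_def by (rule has_real_derivative_orbit[OF diff])
  have E': "(E has_real_derivative \<epsilon> * E s) (at s)" for s
    unfolding E_eq[abs_def] by (auto intro!: derivative_eq_intros)
  have G'_deriv: "(G has_real_derivative G' s) (at s)" for s
    unfolding G_def p_def
    by (rule derivative_eq_intros f' E' refl)+ (simp add: G'_def p_def power2_eq_square algebra_simps)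
  have "continuous_on UNIV f"
    by (rule DERIV_continuous_on[OF has_field_derivative_at_within[OF f']])
  moreover have "continuous_on UNIV E"
    by (rule DERIV_continuous_on[OF has_field_derivative_at_within[OF E']])
  moreover have "continuous_on UNIV X"
    unfolding X_def d_def by (rule continuous_on_orbit_derivative[OF phi])
  ultimately have G'_cont: "continuous_on UNIV G'"
    unfolding G'_def p_def by (intro continuous_intros)
  have zero: "f s = 0" "X s = 0" "N s = 0" if "d s \<notin> \<Omega>" for s
    using test_fun_outside[OF phi that] test_fun_grad_norm_outside[OF phi that]
    by (simp_all add: f_def X_def N_def)
  \<comment> \<open>The orbit tends to the origin, where \<open>\<phi>\<close> need not vanish; the
    decay comes from \<open>exp (a * s)\<close> with \<open>a > 0\<close>.\<close>
  have bot: "(G \<longlongrightarrow> 0) at_bot"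
  proof -
    have "isCont \<phi> 0" by (rule differentiable_imp_continuous_within[OF diff])
    then have lf: "(f \<longlongrightarrow> \<phi> 0) at_bot"
      unfolding f_def d_def by (rule isCont_tendsto_compose[OF _ dilation_tendsto_0[OF g]])
    have e: "((\<lambda>s. exp (c * s)) \<longlongrightarrow> 0) at_bot" if "c > 0" for c :: real
      using filterlim_tendsto_pos_mult_at_bot[OF tendsto_const that filterlim_ident]
      by (rule filterlim_compose[OF exp_at_bot])
    have "(E \<longlongrightarrow> 0 * r powr \<epsilon>) at_bot"
      unfolding E_eq[abs_def] by (intro tendsto_mult tendsto_const e eps)
    then have "(G \<longlongrightarrow> - (h * 0 * (a/2 + \<delta> * (0 * r powr \<epsilon>)) * (\<phi> 0)\<^sup>2)) at_bot"
      unfolding G_def p_def by (intro tendsto_intros e a lf)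
    then show ?thesis by simp
  qed
  have top: "(G \<longlongrightarrow> 0) at_top"
  proof (rule tendsto_eventually)
    show "eventually (\<lambda>s. G s = 0) at_top"
      \<comment> \<open>Beyond this parameter the gauge exceeds \<open>R\<close> and the orbit has
        left \<open>\<Omega>\<close>. The maximum with one keeps the argument of the logarithm
        positive.\<close>
      using eventually_gt_at_top[of "ln (max 1 (R / r))"]
    proof eventually_elim
      case (elim s)
      have "R / r \<le> exp (ln (max 1 (R / r)))" by simp
      also have "\<dots> < exp s" by (rule exp_less_mono[OF elim])
      finally have "R < gauge \<gamma> (d s)" using r by (simp add: gd field_simps)
      then have "d s \<notin> \<Omega>" using R[of "d s"] by auto
      then show ?case using zero by (simp add: G_def)
    qed
  qed
  define F1 where "F1 s = exp (Q * s) * (W (d s) * (N s)\<^sup>2)" for s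
  define F2 where "F2 s = exp (Q * s) * ((a/2)\<^sup>2 * (H (d s) * (f s)\<^sup>2)
           + K * (W (d s) * gauge \<gamma> (d s) powr \<epsilon> * (N s)\<^sup>2))" for s
  \<comment> \<open>The bound on \<open>E s\<close> is available only inside
    \<open>\<Omega>\<close>; outside, all terms vanish.\<close>
  have le: "F2 s + G' s \<le> F1 s" for s
  proof (cases "d s \<in> \<Omega>")
    case True
    have El: "E s \<le> R powr \<epsilon>" "0 \<le> E s"
      using R[OF True] r eps by (auto simp: E_def gd intro!: powr_mono2)
    have KE: "K * E s \<le> 1"
      using mult_left_mono[OF El(1), of K] K by linarith
    have "h * exp (a * s) * ((a/2)\<^sup>2 * (f s)\<^sup>2 - ((a * (a/2 + \<delta> * E s) + \<epsilon> * \<delta> * E s) * (f s)\<^sup>2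
        + 2 * (a/2 + \<delta> * E s) * f s * X s)) \<le> h * exp (a * s) * ((1 - K * E s) * (X s)\<^sup>2)"
      using hardy[OF El(2,1)] h by (intro mult_left_mono) auto
    then have "(a/2)\<^sup>2 * (h * exp (a * s) * (f s)\<^sup>2) + G' s \<le> (1 - K * E s) * (h * exp (a * s) * (X s)\<^sup>2)"
      by (simp add: G'_def p_def algebra_simps)
    also have "h * exp (a * s) * (X s)\<^sup>2 = exp (Q * s) * (H (d s) * (X s)\<^sup>2)"
      using Hd[of s] by (simp add: mult_ac)
    \<comment> \<open>Since \<open>1 - K E\<close> is nonnegative, the radial derivative may be
      replaced here by the full gradient. This is why the remainder \<open>K E F1\<close> contains
      the full gradient.\<close>
    also have "(1 - K * E s) * \<dots> \<le> (1 - K * E s) * F1 s"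
      unfolding F1_def using KE WN by (intro mult_left_mono) auto
    finally have "(a/2)\<^sup>2 * (h * exp (a * s) * (f s)\<^sup>2) + G' s \<le> F1 s - K * E s * F1 s"
      by (simp add: algebra_simps)
    moreover have "F2 s = (a/2)\<^sup>2 * (h * exp (a * s) * (f s)\<^sup>2) + K * E s * F1 s"
    proof -
      have "h * exp (a * s) * (f s)\<^sup>2 = exp (Q * s) * (H (d s) * (f s)\<^sup>2)"
        using Hd[of s] by (simp add: mult_ac)
      moreover have "K * E s * F1 s = exp (Q * s) * (K * (W (d s) * gauge \<gamma> (d s) powr \<epsilon> * (N s)\<^sup>2))"
        by (simp add: F1_def E_def gd)
      ultimately show ?thesis
        unfolding F2_def by (simp only: distrib_left mult.left_commute)
    qed
    ultimately show ?thesis by linarith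
  next
    case False
    then show ?thesis using zero[OF False] by (simp add: F1_def F2_def G'_def)
  qed
  note [measurable] = measurable_grushin_grad_norm[OF phi]
  have [measurable]: "\<phi> \<in> borel_measurable borel"
    by (intro borel_measurable_continuous_onI continuous_at_imp_continuous_on ballI
        differentiable_imp_continuous_within diff)
  have "(\<integral>\<^sup>+s. ennreal (F2 s) \<partial>lborel) \<le> (\<integral>\<^sup>+s. ennreal (F1 s) \<partial>lborel)"
  proof (rule nn_integral_le_of_exact_derivative[OF _ _ _ _ le G'_deriv G'_cont bot top])
    show "F1 \<in> borel_measurable borel" "F2 \<in> borel_measurable borel"
      unfolding F1_def F2_def N_def f_def d_def W_def H_def by measurable
    show "0 \<le> F1 s" "0 \<le> F2 s" for s
      using K by (simp_all add: F1_def F2_def W_def H_def)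
  qed
  then show ?thesis
    by (simp add: F1_def F2_def N_def f_def d_def)
qed

section \<open>The Hardy inequality with remainder\<close>

text \<open>Both sides are written in polar coordinates and compared orbit by orbit.
  \<open>K\<close> is fixed from \<open>a\<close>, \<open>\<epsilon>\<close> and a gauge bound on
  \<open>\<Omega>\<close> before \<open>\<phi>\<close> is introduced, which gives the
  uniformity.\<close>

lemma hardy_weighted_remainder:
  fixes \<Omega> :: "((real^'m::finite) \<times> (real^'k::finite)) set" and \<gamma> \<alpha> t \<epsilon> :: real
  defines "Q \<equiv> real CARD('m) + (1 + \<gamma>) * real CARD('k)"
  defines "W \<equiv> \<lambda>z::(real^'m) \<times> (real^'k). gauge \<gamma> z powr \<alpha> * gauge_slope \<gamma> z powr t"
  defines "H \<equiv> \<lambda>z::(real^'m) \<times> (real^'k). gauge \<gamma> z powr \<alpha> * gauge_slope \<gamma> z powr (t + 2) / (gauge \<gamma> z)\<^sup>2"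
  assumes g: "\<gamma> > 0" and bd: "bounded \<Omega>" and a: "Q + \<alpha> - 2 > 0" and eps: "\<epsilon> > 0"
  obtains K where "K > 0" and "\<And>\<phi>. test_fun \<Omega> \<phi> \<Longrightarrow>
     ennreal (((Q + \<alpha> - 2) / 2)\<^sup>2) * (\<integral>\<^sup>+z. ennreal (H z * (\<phi> z)\<^sup>2) \<partial>lborel)
       + ennreal K * (\<integral>\<^sup>+z. ennreal (W z * gauge \<gamma> z powr \<epsilon> * (grushin_grad_norm \<gamma> \<phi> z)\<^sup>2) \<partial>lborel)
     \<le> (\<integral>\<^sup>+z. ennreal (W z * (grushin_grad_norm \<gamma> \<phi> z)\<^sup>2) \<partial>lborel)"
proof -
  define a where "a = Q + \<alpha> - 2"
  obtain R where R: "R > 0" "\<And>z. z \<in> \<Omega> \<Longrightarrow> gauge \<gamma> z < R"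
    using bounded_gauge_le[OF bd g] by metis
  have a0: "a > 0" using a by (simp add: a_def)
  have E0: "R powr \<epsilon> > 0" using R by simp
  obtain K \<delta> where K: "K > 0" "\<delta> > 0" "K * R powr \<epsilon> \<le> 1"
    and hardy: "\<And>E f X. 0 \<le> E \<Longrightarrow> E \<le> R powr \<epsilon> \<Longrightarrow>
      (a/2)\<^sup>2 * f\<^sup>2 - ((a * (a/2 + \<delta> * E) + \<epsilon> * \<delta> * E) * f\<^sup>2 + 2 * (a/2 + \<delta> * E) * f * X) \<le> (1 - K * E) * X\<^sup>2"
    using hardy_pointwise[OF a0 eps E0] by metis
  show ?thesis
  proof (rule that[OF K(1)])
    fix \<phi> :: "(real^'m) \<times> (real^'k) \<Rightarrow> real"
    assume phi: "test_fun \<Omega> \<phi>"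
    note [measurable] = measurable_grushin_grad_norm[OF phi]
    have [measurable]: "\<phi> \<in> borel_measurable borel"
      by (intro borel_measurable_continuous_onI continuous_at_imp_continuous_on ballI
          differentiable_imp_continuous_within test_fun_differentiable[OF phi])
    have [measurable]: "W \<in> borel_measurable borel" "H \<in> borel_measurable borel"
      unfolding W_def H_def by measurable
    have pos: "W z \<ge> 0" "H z \<ge> 0" for z by (simp_all add: W_def H_def)
    define N where "N = grushin_grad_norm \<gamma> \<phi>"
    have [measurable]: "N \<in> borel_measurable borel" unfolding N_def by measurable
    define F where "F z = (a/2)\<^sup>2 * (H z * (\<phi> z)\<^sup>2) + K * (W z * gauge \<gamma> z powr \<epsilon> * (N z)\<^sup>2)" for z
    have "ennreal ((a/2)\<^sup>2) * (\<integral>\<^sup>+z. ennreal (H z * (\<phi> z)\<^sup>2) \<partial>lborel)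
       + ennreal K * (\<integral>\<^sup>+z. ennreal (W z * gauge \<gamma> z powr \<epsilon> * (N z)\<^sup>2) \<partial>lborel)
       = (\<integral>\<^sup>+z. ennreal ((a/2)\<^sup>2) * ennreal (H z * (\<phi> z)\<^sup>2)
            + ennreal K * ennreal (W z * gauge \<gamma> z powr \<epsilon> * (N z)\<^sup>2) \<partial>lborel)"
      by (simp add: nn_integral_add nn_integral_cmult)
    also have "\<dots> = (\<integral>\<^sup>+z. ennreal (F z) \<partial>lborel)"
      using K pos by (intro nn_integral_cong)
        (simp add: F_def ennreal_mult[symmetric] ennreal_plus[symmetric] del: ennreal_plus)
    also have "\<dots> = (\<integral>\<^sup>+z\<in>{z. 1 \<le> gauge \<gamma> z \<and> gauge \<gamma> z < exp 1}.
       (\<integral>\<^sup>+s. ennreal (exp (Q * s)) * ennreal (F (dilation \<gamma> s z)) \<partial>lborel) \<partial>lborel)"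
      unfolding Q_def by (rule nn_integral_polar[OF g]) (simp add: F_def)
    also have "\<dots> \<le> (\<integral>\<^sup>+z\<in>{z. 1 \<le> gauge \<gamma> z \<and> gauge \<gamma> z < exp 1}.
       (\<integral>\<^sup>+s. ennreal (exp (Q * s)) * ennreal (W (dilation \<gamma> s z) * (N (dilation \<gamma> s z))\<^sup>2) \<partial>lborel) \<partial>lborel)"
    proof (intro nn_integral_mono_AE)
      show "AE z in lborel. (\<integral>\<^sup>+s. ennreal (exp (Q * s)) * ennreal (F (dilation \<gamma> s z)) \<partial>lborel)
            * indicator {z. 1 \<le> gauge \<gamma> z \<and> gauge \<gamma> z < exp 1} z
          \<le> (\<integral>\<^sup>+s. ennreal (exp (Q * s)) * ennreal (W (dilation \<gamma> s z) * (N (dilation \<gamma> s z))\<^sup>2) \<partial>lborel)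
            * indicator {z. 1 \<le> gauge \<gamma> z \<and> gauge \<gamma> z < exp 1} z"
        using AE_fst_nonzero
      proof eventually_elim
        case (elim z)
        show ?case
          using orbit_hardy[where \<alpha> = \<alpha> and t = t, OF g elim phi R(2) a0 a_def eps K hardy]
          by (intro mult_right_mono) (simp_all add: F_def N_def W_def H_def ennreal_mult')
      qed
    qed
    also have "\<dots> = (\<integral>\<^sup>+z. ennreal (W z * (N z)\<^sup>2) \<partial>lborel)"
      unfolding Q_def by (rule nn_integral_polar[OF g, symmetric]) simp
    finally show "ennreal (((Q + \<alpha> - 2) / 2)\<^sup>2) * (\<integral>\<^sup>+z. ennreal (H z * (\<phi> z)\<^sup>2) \<partial>lborel)
       + ennreal K * (\<integral>\<^sup>+z. ennreal (W z * gauge \<gamma> z powr \<epsilon> * (grushin_grad_norm \<gamma> \<phi> z)\<^sup>2) \<partial>lborel)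
     \<le> (\<integral>\<^sup>+z. ennreal (W z * (grushin_grad_norm \<gamma> \<phi> z)\<^sup>2) \<partial>lborel)"
      by (simp add: N_def a_def)
  qed
qed

section \<open>From the weighted remainder to the \<open>L^q\<close> remainder\<close>

theorem theorem3p4:
  fixes \<Omega> :: "((real^'m) \<times> (real^'k)) set"
    and \<gamma> q \<alpha> t :: real
  defines "Q \<equiv> real CARD('m) + (1 + \<gamma>) * real CARD('k)"
  assumes "\<gamma> > 0"
    and "smooth_bounded_domain \<Omega>" and "(0, 0) \<in> \<Omega>"
    and "1 < q" and "q < 2"
    and "Q + \<alpha> - 2 > 0"
  shows "\<exists>C>0. \<forall>\<phi>. test_fun \<Omega> \<phi> \<longrightarrow>
    (\<integral>\<^sup>+z\<in>\<Omega>. ennreal (gauge \<gamma> z powr \<alpha> * grushin_grad_norm \<gamma> (gauge \<gamma>) z powr t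
                         * (grushin_grad_norm \<gamma> \<phi> z)\<^sup>2) \<partial>lborel)
    \<ge> ennreal (((Q + \<alpha> - 2) / 2)\<^sup>2) *
        (\<integral>\<^sup>+z\<in>\<Omega>. ennreal (gauge \<gamma> z powr \<alpha> * grushin_grad_norm \<gamma> (gauge \<gamma>) z powr (t + 2)
                         / (gauge \<gamma> z)\<^sup>2 * (\<phi> z)\<^sup>2) \<partial>lborel)
      + ennreal C * ennreal_powr
        (\<integral>\<^sup>+z\<in>\<Omega>. ennreal (grushin_grad_norm \<gamma> \<phi> z powr q *
           (grushin_grad_norm \<gamma> (gauge \<gamma>) z powr t * gauge \<gamma> z powr \<alpha>) powr (q / 2)) \<partial>lborel) (2 / q)"
proof -
  note g = \<open>\<gamma> > 0\<close>
  have bd: "bounded \<Omega>" and op: "open \<Omega>"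
    using \<open>smooth_bounded_domain \<Omega>\<close> by (simp_all add: smooth_bounded_domain_def)
  have [measurable]: "\<Omega> \<in> sets borel" using op by simp
  define \<theta> where "\<theta> = q / 2"
  have th: "0 < \<theta>" "\<theta> < 1" using \<open>1 < q\<close> \<open>q < 2\<close> by (simp_all add: \<theta>_def)
  have Q: "Q > 0" unfolding Q_def using g by (intro add_pos_nonneg) auto
  \<comment> \<open>The choice makes \<open>\<epsilon> \<theta> = (Q / 2) (1 - \<theta>)\<close>, so
    the powers of the gauge cancel in \<open>X powr \<theta> * Y powr (1 - \<theta>)\<close>
    below.\<close>
  define \<epsilon> where "\<epsilon> = Q / 2 * (1 - \<theta>) / \<theta>"
  have eps: "\<epsilon> > 0" using Q th by (simp add: \<epsilon>_def)
  define W where "W z = gauge \<gamma> z powr \<alpha> * gauge_slope \<gamma> z powr t" for z :: "(real^'m) \<times> (real^'k)"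
  define H where "H z = gauge \<gamma> z powr \<alpha> * gauge_slope \<gamma> z powr (t + 2) / (gauge \<gamma> z)\<^sup>2"
    for z :: "(real^'m) \<times> (real^'k)"
  have [measurable]: "W \<in> borel_measurable borel" "H \<in> borel_measurable borel"
    unfolding W_def[abs_def] H_def[abs_def] by measurable
  have pos: "W z \<ge> 0" "H z \<ge> 0" for z by (simp_all add: W_def H_def)
  obtain K where K: "K > 0" and main: "\<And>\<phi>. test_fun \<Omega> \<phi> \<Longrightarrow>
     ennreal (((Q + \<alpha> - 2) / 2)\<^sup>2) * (\<integral>\<^sup>+z. ennreal (H z * (\<phi> z)\<^sup>2) \<partial>lborel)
       + ennreal K * (\<integral>\<^sup>+z. ennreal (W z * gauge \<gamma> z powr \<epsilon> * (grushin_grad_norm \<gamma> \<phi> z)\<^sup>2) \<partial>lborel)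
     \<le> (\<integral>\<^sup>+z. ennreal (W z * (grushin_grad_norm \<gamma> \<phi> z)\<^sup>2) \<partial>lborel)"
    using hardy_weighted_remainder[OF g bd \<open>Q + \<alpha> - 2 > 0\<close>[unfolded Q_def] eps, of t]
    unfolding W_def H_def Q_def by blast
  obtain R where R: "R > 0" "\<And>z. z \<in> \<Omega> \<Longrightarrow> gauge \<gamma> z < R"
    using bounded_gauge_le[OF bd g] by metis
  \<comment> \<open>The exponent \<open>Q / 2\<close> lies strictly below \<open>Q\<close>, so the
    dual weight is integrable over the bounded set \<open>\<Omega>\<close>.\<close>
  define Y where "Y z = indicator \<Omega> z * gauge \<gamma> z powr - (Q / 2)" for z
  have "(\<integral>\<^sup>+z. ennreal (Y z) \<partial>lborel) = (\<integral>\<^sup>+z\<in>\<Omega>. ennreal (gauge \<gamma> z powr - (Q / 2)) \<partial>lborel)"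
    by (intro nn_integral_cong) (simp add: Y_def indicator_def)
  also have "\<dots> < \<infinity>"
    using Q by (intro nn_integral_gauge_powr_finite[OF g R(2,1)]) (simp_all add: Q_def)
  finally have Yfin: "(\<integral>\<^sup>+z. ennreal (Y z) \<partial>lborel) < \<infinity>" .
  \<comment> \<open>The summand one ensures \<open>J > 0\<close>.\<close>
  define J where "J = enn2real (\<integral>\<^sup>+z. ennreal (Y z) \<partial>lborel) + 1"
  have J: "J > 0" by (simp add: J_def add_nonneg_pos)
  have YJ: "(\<integral>\<^sup>+z. ennreal (Y z) \<partial>lborel) \<le> ennreal J"
  proof -
    have "(\<integral>\<^sup>+z. ennreal (Y z) \<partial>lborel) = ennreal (enn2real (\<integral>\<^sup>+z. ennreal (Y z) \<partial>lborel))"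
      using Yfin by simp
    also have "\<dots> \<le> ennreal J" by (rule ennreal_leI) (simp add: J_def)
    finally show ?thesis .
  qed
  have [measurable]: "Y \<in> borel_measurable borel" unfolding Y_def[abs_def] by measurable
  define L where "L = J powr ((1 - \<theta>) / \<theta>)"
  have L: "L > 0" using J by (simp add: L_def)
  show ?thesis
  \<comment> \<open>\<open>L\<close> is the factor lost in Hoelder's inequality, so
    \<open>K / L\<close> times the \<open>L^q\<close> term is at most the weighted remainder with
    constant \<open>K\<close>.\<close>
  proof (intro exI[of _ "K / L"] conjI allI impI)
    show "K / L > 0" using K L by simp
    fix \<phi> assume phi: "test_fun \<Omega> \<phi>"
    define N where "N = grushin_grad_norm \<gamma> \<phi>"
    have [measurable]: "N \<in> borel_measurable borel"
      unfolding N_def by (rule measurable_grushin_grad_norm[OF phi])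
    have N0: "N z = 0" "\<phi> z = 0" if "z \<notin> \<Omega>" for z
      using test_fun_grad_norm_outside[OF phi that] test_fun_outside[OF phi that] by (simp_all add: N_def)
    have Npos: "N z \<ge> 0" for z by (simp add: N_def grushin_grad_norm_def sum_nonneg)
    have slope: "AE z in lborel. grushin_grad_norm \<gamma> (gauge \<gamma>) z = gauge_slope \<gamma> (z :: (real^'m) \<times> (real^'k))"
      using AE_fst_nonzero by eventually_elim (rule grushin_grad_norm_gauge[OF g])
    define X where "X z = W z * gauge \<gamma> z powr \<epsilon> * (N z)\<^sup>2" for z
    have [measurable]: "X \<in> borel_measurable borel" unfolding X_def[abs_def] by measurable
    \<comment> \<open>In these identities the slope replaces the gradient norm of the gauge almost
      everywhere, and the restriction to \<open>\<Omega>\<close> disappears because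
      \<open>\<phi>\<close> and its gradient vanish outside.\<close>
    have i1: "(\<integral>\<^sup>+z\<in>\<Omega>. ennreal (gauge \<gamma> z powr \<alpha> * grushin_grad_norm \<gamma> (gauge \<gamma>) z powr t * (N z)\<^sup>2) \<partial>lborel)
        = (\<integral>\<^sup>+z. ennreal (W z * (N z)\<^sup>2) \<partial>lborel)"
      by (rule nn_integral_cong_AE)
        (use slope in eventually_elim, auto simp: W_def indicator_def N0)
    have i2: "(\<integral>\<^sup>+z\<in>\<Omega>. ennreal (gauge \<gamma> z powr \<alpha> * grushin_grad_norm \<gamma> (gauge \<gamma>) z powr (t + 2)
            / (gauge \<gamma> z)\<^sup>2 * (\<phi> z)\<^sup>2) \<partial>lborel) = (\<integral>\<^sup>+z. ennreal (H z * (\<phi> z)\<^sup>2) \<partial>lborel)"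
      by (rule nn_integral_cong_AE)
        (use slope in eventually_elim, auto simp: H_def indicator_def N0)
    have i3: "(\<integral>\<^sup>+z\<in>\<Omega>. ennreal (N z powr q *
           (grushin_grad_norm \<gamma> (gauge \<gamma>) z powr t * gauge \<gamma> z powr \<alpha>) powr (q / 2)) \<partial>lborel)
        = (\<integral>\<^sup>+z. ennreal (X z powr \<theta> * Y z powr (1 - \<theta>)) \<partial>lborel)"
    proof (rule nn_integral_cong_AE)
      show "AE z in lborel. ennreal (N z powr q *
           (grushin_grad_norm \<gamma> (gauge \<gamma>) z powr t * gauge \<gamma> z powr \<alpha>) powr (q / 2)) * indicator \<Omega> z
         = ennreal (X z powr \<theta> * Y z powr (1 - \<theta>))"
        using AE_fst_nonzero slope
      proof eventually_elim
        case (elim z)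
        show ?case
        proof (cases "z \<in> \<Omega>")
          case True
          define r where "r = gauge \<gamma> z"
          have r: "r > 0" unfolding r_def by (rule gauge_pos[OF elim(1) g])
          have "((N z)\<^sup>2) powr \<theta> = N z powr q"
            using Npos[of z] by (cases "N z = 0") (simp_all add: \<theta>_def powr_powr flip: powr_numeral)
          moreover have "(r powr \<epsilon>) powr \<theta> * (r powr - (Q / 2)) powr (1 - \<theta>) = 1"
          proof -
            \<comment> \<open>This is the equation that defines \<open>\<epsilon>\<close>; what is
              left of the product is \<open>W powr \<theta>\<close> times the \<open>q\<close>-th
              power of the gradient norm.\<close>
            have "\<epsilon> * \<theta> + - (Q / 2) * (1 - \<theta>) = 0" using th by (simp add: \<epsilon>_def)
            then show ?thesis using r by (simp only: powr_powr powr_add[symmetric]) simp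
          qed
          moreover have "X z powr \<theta> * Y z powr (1 - \<theta>) =
              W z powr \<theta> * ((N z)\<^sup>2) powr \<theta> * ((r powr \<epsilon>) powr \<theta> * (r powr - (Q / 2)) powr (1 - \<theta>))"
            using pos True by (simp add: X_def Y_def r_def powr_mult mult_ac)
          ultimately show ?thesis
            using True elim(2) by (simp add: W_def \<theta>_def mult_ac)
        qed (use N0 th in \<open>simp add: X_def\<close>)
      qed
    qed
    have "ennreal (K / L) * ennreal_powr (\<integral>\<^sup>+z. ennreal (X z powr \<theta> * Y z powr (1 - \<theta>)) \<partial>lborel) (1 / \<theta>)
        \<le> ennreal (K / L) * (ennreal L * (\<integral>\<^sup>+z. ennreal (X z) \<partial>lborel))"
      unfolding L_def
      by (intro mult_left_mono Holder_ennreal_powr th YJ J) (auto simp: X_def Y_def pos)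
    also have "\<dots> = ennreal K * (\<integral>\<^sup>+z. ennreal (X z) \<partial>lborel)"
      using K L by (simp add: mult.assoc[symmetric] ennreal_mult[symmetric])
    finally have "ennreal (((Q + \<alpha> - 2) / 2)\<^sup>2) * (\<integral>\<^sup>+z. ennreal (H z * (\<phi> z)\<^sup>2) \<partial>lborel)
       + ennreal (K / L) * ennreal_powr (\<integral>\<^sup>+z. ennreal (X z powr \<theta> * Y z powr (1 - \<theta>)) \<partial>lborel) (1 / \<theta>)
       \<le> (\<integral>\<^sup>+z. ennreal (W z * (N z)\<^sup>2) \<partial>lborel)"
      using main[OF phi] unfolding X_def N_def by (meson add_left_mono order_trans)
    then show "ennreal (((Q + \<alpha> - 2) / 2)\<^sup>2) *
        (\<integral>\<^sup>+z\<in>\<Omega>. ennreal (gauge \<gamma> z powr \<alpha> * grushin_grad_norm \<gamma> (gauge \<gamma>) z powr (t + 2)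
                         / (gauge \<gamma> z)\<^sup>2 * (\<phi> z)\<^sup>2) \<partial>lborel)
      + ennreal (K / L) * ennreal_powr
        (\<integral>\<^sup>+z\<in>\<Omega>. ennreal (grushin_grad_norm \<gamma> \<phi> z powr q *
           (grushin_grad_norm \<gamma> (gauge \<gamma>) z powr t * gauge \<gamma> z powr \<alpha>) powr (q / 2)) \<partial>lborel) (2 / q)
      \<le> (\<integral>\<^sup>+z\<in>\<Omega>. ennreal (gauge \<gamma> z powr \<alpha> * grushin_grad_norm \<gamma> (gauge \<gamma>) z powr t
                         * (grushin_grad_norm \<gamma> \<phi> z)\<^sup>2) \<partial>lborel)"
      unfolding N_def[symmetric] i1 i2 i3 by (simp add: \<theta>_def)
  qed
qed

end
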